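(* Let $d\in\mathbb{N}$. Suppose that for every Delone set $Y\subset\mathbb{R}^d$ there exists either a bijection $Y\to\mathbb{Z}^d$ that is Lipschitz and pointwise co-Lipschitz, or a bijection $Y\to\mathbb{Z}^d$ that is co-Lipschitz and pointwise Lipschitz. Then for every measurable function $\rho:\mathbb{R}^d\to\mathbb{R}$ with $0<\inf\rho\le\sup\rho<\infty$ there exists a Lipschitz regular map $f:\mathbb{R}^d\to\mathbb{R}^d$ satisfying either $$f\#(\rho\mathcal{L})=\mathcal{L}\qquad\text{or}\qquad f\#\mathcal{L}=\rho\mathcal{L}.$$
   Context: $\mathbb{N}=\{1,2,\dots\}$, $\|\cdot\|$ is the Euclidean norm and $\mathcal{L}$ is Lebesgue measure on $\mathbb{R}^d$. $\rho\mathcal{L}$ is the measure $A\mapsto\int_A\rho\,d\mathcal{L}$, and for a measure $\mu$ the pushforward is $f\#\mu(A)=\mu(f^{-1}(A))$. A set $Y\subset\mathbb{R}^d$ is a Delone set if there is $s>0$ such that every closed ball of radius $s$ in $\mathbb{R}^d$ contains at most one point of $Y$, and there is $S>0$ such that every closed ball of radius $S$ in $\mathbb{R}^d$ contains at least one point of $Y$. For $K,X\subseteq\mathbb{R}^d$ and $f:K\to X$: $f$ is Lipschitz at $y\in K$ if there is $L=L(y)>0$ with $\|f(x)-f(y)\|\le L\|x-y\|$ for every $x\in K$; $f$ is pointwise Lipschitz if it is Lipschitz at every $y\in K$. A bijection $f$ is co-Lipschitz (resp. pointwise co-Lipschitz) if $f^{-1}$ is Lipschitz (resp. pointwise Lipschitz).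 A Lipschitz map $f:K\to X$ is Lipschitz regular if there is $C\in\mathbb{N}$ such that for every ball $B\subset X$ of radius $R>0$, the set $f^{-1}(B)$ can be covered by at most $C$ balls of radius $CR$. *)

theory Defs
  imports "HOL-Analysis.Analysis"
begin

definition delone :: "(real^'n) set \<Rightarrow> bool" where
  "delone Y \<longleftrightarrow>
     (\<exists>s>0. \<forall>x. \<exists>\<^sub>\<le>\<^sub>1 y. y \<in> Y \<inter> cball x s) \<and>
     (\<exists>S>0. \<forall>x. \<exists>y. y \<in> Y \<inter> cball x S)"

definition int_lattice :: "(real^'n) set" where
  "int_lattice = {x. \<forall>i. x $ i \<in> \<int>}"

definition lipschitz_map_on :: "(real^'n) set \<Rightarrow> (real^'n \<Rightarrow> real^'n) \<Rightarrow> bool" where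
  "lipschitz_map_on K f \<longleftrightarrow> (\<exists>L. L-lipschitz_on K f)"

definition lipschitz_at :: "(real^'n) set \<Rightarrow> (real^'n \<Rightarrow> real^'n) \<Rightarrow> real^'n \<Rightarrow> bool" where
  "lipschitz_at K f y \<longleftrightarrow> (\<exists>L>0. \<forall>x\<in>K. norm (f x - f y) \<le> L * norm (x - y))"

definition pointwise_lipschitz_on :: "(real^'n) set \<Rightarrow> (real^'n \<Rightarrow> real^'n) \<Rightarrow> bool" where
  "pointwise_lipschitz_on K f \<longleftrightarrow> (\<forall>y\<in>K. lipschitz_at K f y)"

text \<open>The next two notions are meant for maps that are injective on \<open>K\<close>; the inverse lives on
  the image \<open>f ` K\<close>.\<close>

definition co_lipschitz_on :: "(real^'n) set \<Rightarrow> (real^'n \<Rightarrow> real^'n) \<Rightarrow> bool" where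
  "co_lipschitz_on K f \<longleftrightarrow> lipschitz_map_on (f ` K) (inv_into K f)"

definition pointwise_co_lipschitz_on :: "(real^'n) set \<Rightarrow> (real^'n \<Rightarrow> real^'n) \<Rightarrow> bool" where
  "pointwise_co_lipschitz_on K f \<longleftrightarrow> pointwise_lipschitz_on (f ` K) (inv_into K f)"

text \<open>Balls are open balls of the metric spaces \<open>K\<close> and \<open>X\<close>, hence the restriction of the centres.
  Closed balls give the same notion, with a different constant \<open>C\<close>.\<close>

definition lipschitz_regular_on ::
    "(real^'n) set \<Rightarrow> (real^'n) set \<Rightarrow> (real^'n \<Rightarrow> real^'n) \<Rightarrow> bool" where
  "lipschitz_regular_on K X f \<longleftrightarrow>
     f \<in> K \<rightarrow> X \<and> lipschitz_map_on K f \<and>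
     (\<exists>C::nat. C \<ge> 1 \<and>
       (\<forall>x\<in>X. \<forall>R>0. \<exists>T\<subseteq>K. finite T \<and> card T \<le> C \<and>
          K \<inter> f -` ball x R \<subseteq> (\<Union>c\<in>T. ball c (real C * R))))"

text \<open>The measure \<open>\<rho>\<L>\<close>; \<open>ennreal\<close> truncates negative values, so this is meaningful for
  \<open>\<rho> \<ge> 0\<close> only.\<close>

definition weighted_lebesgue :: "(real^'n \<Rightarrow> real) \<Rightarrow> (real^'n) measure" where
  "weighted_lebesgue \<rho> = density lebesgue (\<lambda>x. ennreal (\<rho> x))"

end

theory Submission
  imports Defs "HOL-Complex_Analysis.Great_Picard"
begin

text \<open>Choose a weight \<open>w\<close> that looks like \<open>\<rho>\<close> around the origin at rapidly growing scales \<open>s k\<close>, and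
  a Delone set \<open>Y\<close> whose counting measure follows \<open>w\<L>\<close> up to a bounded displacement: cut every unit
  tube parallel to a coordinate axis into slabs of \<open>w\<close>-mass one. The lattice plays the same role for
  \<open>\<L>\<close>. A Lipschitz bijection \<open>h\<close> between the two sets, rescaled by \<open>s k\<close>, subconverges to a Lipschitz
  map \<open>f\<close> transporting one limit density to the other. No mass escapes to infinity, since all scales
  are centred at the origin, so that the Lipschitz condition for the inverse is needed at one point only.
  Finally, a Lipschitz map that transports one density bounded away from zero and infinity to another
  is Lipschitz regular, by a volume packing argument.\<close>

text \<open>A pointwise co-Lipschitz condition has a constant for each base point and no control
  over how it varies. Patches of \<open>\<rho>\<close> placed around distant centres would call for
  a bound on infinitely many of these constants, hence the single centre. One estimate at one base
  point turns into \<open>norm x \<le> K * norm (f x)\<close> in the limit, because its additive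
  offsets are divided by \<open>s k\<close>. The same estimate keeps preimages of bounded sets in a
  fixed ball, so that one dominating function serves all scales. Since the rescaled weights converge
  pointwise off the origin, dominated convergence is enough to pass to the limit in the exact
  identity that a bijection of discrete sets provides. The disjunction in the conclusion mirrors
  that of the hypothesis: whichever of the bijection and its inverse is Lipschitz gets rescaled, and
  the weight of its source becomes the density that is pushed forward.\<close>

section \<open>Half-open boxes and bounds for weighted Lebesgue measure\<close>

lemma half_open_box:
  fixes l u :: "real^'n"
  assumes "\<And>i. l $ i \<le> u $ i"
  shows half_open_box_sets: "{x. \<forall>i. l $ i \<le> x $ i \<and> x $ i < u $ i} \<in> sets borel"
    and emeasure_half_open_box:
      "emeasure lebesgue {x. \<forall>i. l $ i \<le> x $ i \<and> x $ i < u $ i} = ennreal (\<Prod>i\<in>UNIV. u $ i - l $ i)"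
proof -
  let ?H = "{x. \<forall>i. l $ i \<le> x $ i \<and> x $ i < u $ i}"
  have eq: "?H = (\<Inter>i. {x. l $ i \<le> x $ i} \<inter> {x. x $ i < u $ i})"
    by auto
  have m: "{x :: real^'n. l $ i \<le> x $ i} \<inter> {x. x $ i < u $ i} \<in> sets borel" for i
  proof -
    have "closed {x :: real^'n. l $ i \<le> x $ i}"
      by (intro closed_Collect_le continuous_intros)
    moreover have "open {x :: real^'n. x $ i < u $ i}"
      by (intro open_Collect_less continuous_intros)
    ultimately show ?thesis by (intro sets.Int borel_closed borel_open)
  qed
  show borel: "?H \<in> sets borel"
    unfolding eq by (intro sets.countable_INT') (use m in auto)
  have prod: "(\<Prod>b\<in>Basis. (u - l) \<bullet> b) = (\<Prod>i\<in>UNIV. u $ i - l $ i)"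
  proof -
    have "(\<Prod>b\<in>Basis. (u - l) \<bullet> b) = (\<Prod>b\<in>(\<lambda>i. axis i 1) ` UNIV. (u - l) \<bullet> b)"
      by (rule prod.cong) (auto simp: Basis_vec_def)
    also have "\<dots> = (\<Prod>i\<in>UNIV. u $ i - l $ i)"
      by (subst prod.reindex) (auto simp: inj_on_def axis_eq_axis inner_axis)
    finally show ?thesis .
  qed
  have le: "\<forall>b\<in>Basis. l \<bullet> b \<le> u \<bullet> b"
    using assms by (auto simp: Basis_vec_def inner_axis)
  have "box l u \<subseteq> ?H" "?H \<subseteq> cbox l u"
    by (auto simp: mem_box_cart less_imp_le)
  then have "emeasure lebesgue (box l u) \<le> emeasure lebesgue ?H"
      "emeasure lebesgue ?H \<le> emeasure lebesgue (cbox l u)"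
    using borel by (auto intro!: emeasure_mono)
  then show "emeasure lebesgue ?H = ennreal (\<Prod>i\<in>UNIV. u $ i - l $ i)"
    using le prod by (simp add: emeasure_lborel_box_eq emeasure_lborel_cbox_eq)
qed

lemma sets_weighted_lebesgue [simp, measurable_cong]: "sets (weighted_lebesgue \<rho>) = sets lebesgue"
  and space_weighted_lebesgue [simp]: "space (weighted_lebesgue \<rho>) = UNIV"
  by (simp_all add: weighted_lebesgue_def)

lemma weighted_lebesgue_one: "weighted_lebesgue (\<lambda>_. 1) = lebesgue"
  by (simp add: weighted_lebesgue_def density_1)

lemma emeasure_weighted_lebesgue_le:
  assumes "w \<in> borel_measurable lebesgue" "\<And>x. w x \<le> C" "0 \<le> C" "E \<in> sets lebesgue"
  shows "emeasure (weighted_lebesgue w) E \<le> ennreal C * emeasure lebesgue E"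
proof -
  have "emeasure (weighted_lebesgue w) E = (\<integral>\<^sup>+x. ennreal (w x) * indicator E x \<partial>lebesgue)"
    unfolding weighted_lebesgue_def using assms by (intro emeasure_density) auto
  also have "\<dots> \<le> (\<integral>\<^sup>+x. ennreal C * indicator E x \<partial>lebesgue)"
    by (intro nn_integral_mono mult_right_mono ennreal_leI assms) auto
  also have "\<dots> = ennreal C * emeasure lebesgue E"
    using assms by (intro nn_integral_cmult_indicator)
  finally show ?thesis .
qed

lemma emeasure_weighted_lebesgue_ge:
  assumes "w \<in> borel_measurable lebesgue" "\<And>x. c \<le> w x" "0 \<le> c" "E \<in> sets lebesgue"
  shows "ennreal c * emeasure lebesgue E \<le> emeasure (weighted_lebesgue w) E"
proof -
  have "ennreal c * emeasure lebesgue E = (\<integral>\<^sup>+x. ennreal c * indicator E x \<partial>lebesgue)"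
    using assms by (intro nn_integral_cmult_indicator[symmetric])
  also have "\<dots> \<le> (\<integral>\<^sup>+x. ennreal (w x) * indicator E x \<partial>lebesgue)"
    by (intro nn_integral_mono mult_right_mono ennreal_leI assms) auto
  also have "\<dots> = emeasure (weighted_lebesgue w) E"
    unfolding weighted_lebesgue_def using assms by (intro emeasure_density[symmetric]) auto
  finally show ?thesis .
qed

section \<open>Weighted Lebesgue measure versus counting measure\<close>

text \<open>A discrete set \<open>Y\<close> is handled through a map \<open>\<pi>\<close> with range \<open>Y\<close> whose fibres carry unit
  \<open>w\<close>-mass and lie within distance \<open>D\<close> of their base points; thus \<open>\<pi>\<close> pushes \<open>w\<L>\<close> forward to the
  counting measure of \<open>Y\<close>.\<close>

definition discretizes :: "(real^'n \<Rightarrow> real) \<Rightarrow> (real^'n \<Rightarrow> real^'n) \<Rightarrow> real \<Rightarrow> bool" where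
  "discretizes w \<pi> D \<longleftrightarrow> w \<in> borel_measurable lebesgue \<and> countable (range \<pi>) \<and>
     (\<forall>x. norm (\<pi> x - x) \<le> D) \<and>
     (\<forall>y\<in>range \<pi>. \<pi> -` {y} \<in> sets lebesgue \<and> emeasure (weighted_lebesgue w) (\<pi> -` {y}) = 1)"

lemma discretizes_measurable:
  assumes "discretizes w \<pi> D"
  shows "\<pi> \<in> lebesgue \<rightarrow>\<^sub>M count_space (range \<pi>)"
  using assms by (subst measurable_count_space_eq_countable) (auto simp: discretizes_def)

lemma discretizes_distr:
  assumes "discretizes w \<pi> D"
  shows "distr (weighted_lebesgue w) (count_space (range \<pi>)) \<pi> = count_space (range \<pi>)"
proof (rule measure_eqI_countable[where A = "range \<pi>"])
  have m: "\<pi> \<in> weighted_lebesgue w \<rightarrow>\<^sub>M count_space (range \<pi>)"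
    using discretizes_measurable[OF assms] by (simp cong: measurable_cong_sets)
  fix a assume "a \<in> range \<pi>"
  then show "emeasure (distr (weighted_lebesgue w) (count_space (range \<pi>)) \<pi>) {a} =
      emeasure (count_space (range \<pi>)) {a}"
    using assms by (subst emeasure_distr[OF m]) (auto simp: discretizes_def)
qed (use assms in \<open>auto simp: discretizes_def\<close>)

text \<open>A sum over the discrete set is written as an integral over \<open>count_space\<close>,
  where every function is measurable. The identity is the change of variables along
  \<open>\<pi>\<close>; if \<open>\<phi>\<close> is not summable, both Bochner integrals are
  0.\<close>

lemma integral_discretizes:
  fixes \<phi> :: "real^'n \<Rightarrow> real"
  assumes d: "discretizes w \<pi> D" and nonneg: "\<And>x. 0 \<le> w x"
  shows "(\<integral>x. w x * \<phi> (\<pi> x) \<partial>lebesgue) = (\<integral>y. \<phi> y \<partial>count_space (range \<pi>))"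
proof -
  have m: "\<pi> \<in> lebesgue \<rightarrow>\<^sub>M count_space (range \<pi>)"
    by (rule discretizes_measurable[OF d])
  have "(\<integral>x. w x * \<phi> (\<pi> x) \<partial>lebesgue) = (\<integral>x. \<phi> (\<pi> x) \<partial>weighted_lebesgue w)"
    unfolding weighted_lebesgue_def using d nonneg
    by (subst integral_density) (auto simp: discretizes_def intro!: measurable_compose[OF m])
  also have "\<dots> = (\<integral>y. \<phi> y \<partial>distr (weighted_lebesgue w) (count_space (range \<pi>)) \<pi>)"
    using m by (subst integral_distr) (auto cong: measurable_cong_sets)
  finally show ?thesis by (simp add: discretizes_distr[OF d])
qed

text \<open>This is where bijectivity enters: \<open>h\<close> carries one counting measure to the
  other, and each of them is a pushforward of a weighted Lebesgue measure. The result is exact,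
  before any limit is taken.\<close>

lemma integral_discretizes_bij:
  fixes \<phi> :: "real^'n \<Rightarrow> real"
  assumes A: "discretizes wA \<pi>A DA" "\<And>x. 0 \<le> wA x"
    and B: "discretizes wB \<pi>B DB" "\<And>x. 0 \<le> wB x"
    and h: "bij_betw h (range \<pi>A) (range \<pi>B)"
  shows "(\<integral>x. wA x * \<phi> (h (\<pi>A x)) \<partial>lebesgue) = (\<integral>x. wB x * \<phi> (\<pi>B x) \<partial>lebesgue)"
proof -
  have "(\<integral>x. wA x * \<phi> (h (\<pi>A x)) \<partial>lebesgue) = (\<integral>y. \<phi> (h y) \<partial>count_space (range \<pi>A))"
    by (rule integral_discretizes[OF A])
  also have "\<dots> = (\<integral>y. \<phi> y \<partial>count_space (range \<pi>B))"
    by (rule integral_bij_count_space[OF h])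
  also have "\<dots> = (\<integral>x. wB x * \<phi> (\<pi>B x) \<partial>lebesgue)"
    by (rule integral_discretizes[OF B, symmetric])
  finally show ?thesis .
qed

lemma lebesgue_integral_scaleR:
  fixes g :: "real^'n \<Rightarrow> real"
  assumes c: "0 < c" and g: "g \<in> borel_measurable lebesgue"
  shows "(\<integral>x. g x \<partial>lebesgue) = c ^ CARD('n) * (\<integral>x. g (c *\<^sub>R x) \<partial>lebesgue)"
proof -
  \<comment> \<open>The library states the change of variables for diagonal affine maps written in
    the basis; equal entries and shift 0 give multiplication by \<open>c\<close>.\<close>
  have T: "(\<lambda>x :: real^'n. 0 + (\<Sum>j\<in>Basis. (c * (x \<bullet> j)) *\<^sub>R j)) = (*\<^sub>R) c"
    unfolding scaleR_scaleR[symmetric] scaleR_sum_right[symmetric] euclidean_representation by auto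
  have eq: "(lebesgue :: (real^'n) measure) =
      density (distr lebesgue lebesgue ((*\<^sub>R) c)) (\<lambda>_. c ^ CARD('n))"
    using lebesgue_affine_euclidean[where c = "\<lambda>_ :: real^'n. c" and t = 0] c unfolding T by simp
  have "(\<integral>x. g x \<partial>lebesgue) =
      (\<integral>x. c ^ CARD('n) * g x \<partial>distr lebesgue lebesgue ((*\<^sub>R) c))"
    using c g by (subst eq, subst integral_density) auto
  also have "\<dots> = c ^ CARD('n) * (\<integral>x. g (c *\<^sub>R x) \<partial>lebesgue)"
    using g by (subst integral_distr) auto
  finally show ?thesis .
qed

section \<open>Discretizing the constant weight and arbitrary bounded weights\<close>

lemma lattice_discretizes:
  fixes \<pi> :: "real^'n \<Rightarrow> real^'n"
  defines "\<pi> \<equiv> \<lambda>x. \<chi> i. of_int \<lfloor>x $ i\<rfloor>"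
  shows "range \<pi> = int_lattice" and "discretizes (\<lambda>_. 1) \<pi> (real CARD('n))"
proof -
  have lattice_fixed: "\<pi> x = x" if "x \<in> int_lattice" for x
    using that by (auto simp: \<pi>_def int_lattice_def vec_eq_iff)
  from lattice_fixed have "int_lattice \<subseteq> range \<pi>"
    by (metis rangeI subsetI)
  then show range: "range \<pi> = int_lattice"
    by (auto simp: \<pi>_def int_lattice_def)
  have "range \<pi> \<subseteq> range (\<lambda>p :: 'n \<Rightarrow> int. \<chi> i. of_int (p i))"
    by (auto simp: \<pi>_def)
  then have count: "countable (range \<pi>)"
    by (rule countable_subset) simp
  have "norm (\<pi> x - x) \<le> real CARD('n)" for x
  proof -
    have "norm (\<pi> x - x) \<le> (\<Sum>i\<in>UNIV. \<bar>(\<pi> x - x) $ i\<bar>)"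
      by (rule norm_le_l1_cart)
    also have "\<dots> \<le> (\<Sum>i\<in>(UNIV::'n set). 1)"
    proof (rule sum_mono)
      fix i show "\<bar>(\<pi> x - x) $ i\<bar> \<le> 1"
        using floor_correct[of "x $ i"] unfolding \<pi>_def by (simp; linarith)
    qed
    finally show ?thesis by simp
  qed
  moreover have "\<pi> -` {y} \<in> sets lebesgue \<and> emeasure lebesgue (\<pi> -` {y}) = 1" if "y \<in> range \<pi>" for y
  proof -
    have y: "\<And>i. of_int \<lfloor>y $ i\<rfloor> = y $ i"
      using that by (auto simp: \<pi>_def)
    have "\<pi> x = y \<longleftrightarrow> (\<forall>i. \<lfloor>x $ i\<rfloor> = \<lfloor>y $ i\<rfloor>)" for x
      using y by (metis (no_types, lifting) \<pi>_def floor_of_int vec_eq_iff vec_lambda_beta)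
    then have eq: "\<pi> -` {y} = {x. \<forall>i. y $ i \<le> x $ i \<and> x $ i < (\<chi> i. y $ i + 1) $ i}"
      using y by (auto simp: floor_eq_iff)
    show ?thesis
      using half_open_box_sets[of y "\<chi> i. y $ i + 1"] emeasure_half_open_box[of y "\<chi> i. y $ i + 1"]
      unfolding eq by auto
  qed
  moreover have "(\<lambda>_ :: real^'n. 1 :: real) \<in> borel_measurable lebesgue"
    by simp
  ultimately show "discretizes (\<lambda>_. 1) \<pi> (real CARD('n))"
    using count unfolding discretizes_def weighted_lebesgue_one by blast
qed

text \<open>\<open>S\<close> is a distribution function of \<open>m\<close> and \<open>q\<close>
  picks its quantiles. The upper bound makes \<open>S\<close> Lipschitz, the lower bound makes it
  unbounded in both directions, and the intermediate value theorem then reaches every level.\<close>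

lemma additive_interval_function_quantiles:
  fixes m :: "real \<Rightarrow> real \<Rightarrow> real"
  assumes c: "0 < c"
    and lower: "\<And>s t. s \<le> t \<Longrightarrow> c * (t - s) \<le> m s t"
    and upper: "\<And>s t. s \<le> t \<Longrightarrow> m s t \<le> C * (t - s)"
    and add: "\<And>s t u. s \<le> t \<Longrightarrow> t \<le> u \<Longrightarrow> m s u = m s t + m t u"
  obtains S q where "\<And>s t. s \<le> t \<Longrightarrow> S t - S s = m s t" "\<And>y. S (q y) = y"
proof -
  define S where "S t = (if 0 \<le> t then m 0 t else - m t 0)" for t
  have S: "S t - S s = m s t" if "s \<le> t" for s t
    using add[of 0 s t] add[of s 0 t] add[of s t 0] add[of 0 0 0] that by (auto simp: S_def)
  have "c \<le> C"
    using lower[of 0 1] upper[of 0 1] by simp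
  have lip: "\<bar>S t - S s\<bar> \<le> C * \<bar>t - s\<bar>" for s t
  proof (cases "s \<le> t")
    case True
    have "0 \<le> c * (t - s)" using True c by simp
    with lower[OF True] upper[OF True] S[OF True] show ?thesis using True by simp
  next
    case False
    then have *: "t \<le> s" by simp
    have "0 \<le> c * (s - t)" using * c by simp
    with lower[OF *] upper[OF *] S[OF *] show ?thesis using * by simp
  qed
  have "C-lipschitz_on UNIV S"
    using lip \<open>c \<le> C\<close> c by (intro lipschitz_onI) (auto simp: dist_real_def)
  then have cont: "continuous_on UNIV S"
    by (rule lipschitz_on_continuous_on)
  have "\<exists>t. S t = y" for y
  proof -
    \<comment> \<open>Over an interval of this length \<open>S\<close> grows by at least
      \<bar>y\<bar> + \<bar>S 0\<bar>, which suffices to pass \<open>y\<close> on either side of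
      0.\<close>
    define r where "r = (\<bar>y\<bar> + \<bar>S 0\<bar>) / c"
    have r: "0 \<le> r" "c * r = \<bar>y\<bar> + \<bar>S 0\<bar>"
      using c by (auto simp: r_def)
    have "S (- r) \<le> y" "y \<le> S r"
      using lower[of 0 r] lower[of "- r" 0] S[of 0 r] S[of "- r" 0] r by auto
    then show ?thesis
      using IVT'[of S "- r" y r] r continuous_on_subset[OF cont] by auto
  qed
  then obtain q where "\<And>y. S (q y) = y" by metis
  with S that show thesis by blast
qed

text \<open>Along the axis \<open>k\<close>, each tube is cut at the points where its distribution
  function takes integer values, and every slab is represented by its bottom corner. A slab of mass
  one has height between 1/C and 1/c: the lower value separates points of one tube, the upper value
  leaves no large gaps. Points of different tubes differ in an integer coordinate.\<close>

lemma delone_discretization: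
  fixes w :: "real^'n \<Rightarrow> real"
  assumes w: "w \<in> borel_measurable lebesgue"
    and c: "0 < c" and lower: "\<And>x. c \<le> w x" and upper: "\<And>x. w x \<le> C"
  obtains \<pi> D where "discretizes w \<pi> D" "delone (range \<pi>)"
proof -
  have cC: "c \<le> C" using lower[of 0] upper[of 0] by simp
  then have C: "0 < C" using c by simp
  obtain k :: 'n where True by blast
  define l u where "l p s = (\<chi> i. if i = k then s else of_int (p i))"
    and "u p t = (\<chi> i. if i = k then t else of_int (p i) + 1)" for p :: "'n \<Rightarrow> int" and s t :: real
  define slab where
    "slab p s t = {x. \<forall>i. l p s $ i \<le> x $ i \<and> x $ i < u p t $ i}" for p s t
  have slab_iff: "x \<in> slab p s t \<longleftrightarrow>
      (\<forall>i. i \<noteq> k \<longrightarrow> \<lfloor>x $ i\<rfloor> = p i) \<and> s \<le> x $ k \<and> x $ k < t" for x p s t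
    by (auto simp: slab_def l_def u_def floor_eq_iff)
  have slab_sets: "slab p s t \<in> sets lebesgue"
    and slab_emeasure: "emeasure lebesgue (slab p s t) = ennreal (t - s)" if "s \<le> t" for p s t
  proof -
    have le: "l p s $ i \<le> u p t $ i" for i
      using that by (simp add: l_def u_def)
    show "slab p s t \<in> sets lebesgue"
      using half_open_box_sets[OF le] by (simp add: slab_def)
    have "(\<Prod>i\<in>UNIV. u p t $ i - l p s $ i) = (\<Prod>i\<in>UNIV. if i = k then t - s else 1)"
      by (rule prod.cong) (auto simp: l_def u_def)
    then show "emeasure lebesgue (slab p s t) = ennreal (t - s)"
      using emeasure_half_open_box[OF le] unfolding slab_def by simp
  qed
  define m where "m p s t = measure (weighted_lebesgue w) (slab p s t)" for p s t
  have em_le: "emeasure (weighted_lebesgue w) (slab p s t) \<le> ennreal (C * (t - s))"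
    and em_ge: "ennreal (c * (t - s)) \<le> emeasure (weighted_lebesgue w) (slab p s t)"
    if "s \<le> t" for p s t
    using emeasure_weighted_lebesgue_le[OF w upper less_imp_le[OF C] slab_sets[OF that]]
      emeasure_weighted_lebesgue_ge[OF w lower less_imp_le[OF c] slab_sets[OF that]]
      that c C unfolding slab_emeasure[OF that] by (simp_all add: ennreal_mult)
  have em: "emeasure (weighted_lebesgue w) (slab p s t) = ennreal (m p s t)" if "s \<le> t" for p s t
    unfolding m_def by (rule emeasure_eq_ennreal_measure)
      (use em_le[OF that, of p] in \<open>auto simp: top_unique\<close>)
  have "\<exists>S q. (\<forall>s t. s \<le> t \<longrightarrow> S t - S s = m p s t) \<and> (\<forall>y. S (q y) = y)" for p
  proof (rule additive_interval_function_quantiles[OF c])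
    fix s t u :: real
    show "s \<le> t \<Longrightarrow> c * (t - s) \<le> m p s t"
      using em_ge[of s t p] em[of s t p] by (simp add: m_def)
    show "s \<le> t \<Longrightarrow> m p s t \<le> C * (t - s)"
      using em_le[of s t p] em[of s t p] C by (simp add: m_def)
    assume st: "s \<le> t" and tu: "t \<le> u"
    have "slab p s u = slab p s t \<union> slab p t u" "slab p s t \<inter> slab p t u = {}"
      using st tu by (auto simp: slab_iff)
    then have "emeasure (weighted_lebesgue w) (slab p s u) =
        emeasure (weighted_lebesgue w) (slab p s t) + emeasure (weighted_lebesgue w) (slab p t u)"
      using st tu by (simp add: plus_emeasure slab_sets)
    then show "m p s u = m p s t + m p t u"
      using st tu em by (simp add: m_def flip: ennreal_plus)
  qed blast
  then obtain S q where Sm: "\<And>p s t. s \<le> t \<Longrightarrow> S p t - S p s = m p s t"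
    and Sq: "\<And>p y. S p (q p y) = y"
    by metis
  have Slow: "c * (t - s) \<le> S p t - S p s" and Sup: "S p t - S p s \<le> C * (t - s)" if "s \<le> t" for p s t
    using em_ge[OF that, of p] em_le[OF that, of p] em[OF that, of p] Sm[OF that, of p] C that
    by (simp_all add: m_def)
  have S_less: "S p s < S p t" if "s < t" for p s t
    using Slow[of s t p] that c mult_pos_pos[of c "t - s"] by linarith
  have S_le_iff: "S p s \<le> S p t \<longleftrightarrow> s \<le> t" for p s t
    using S_less[of s t p] S_less[of t s p] by (cases s t rule: linorder_cases) auto
  \<comment> \<open>This adjunction turns conditions on the floor of \<open>S\<close> into half-open
    intervals for the coordinate \<open>k\<close>.\<close>
  have q_le_iff: "q p y \<le> t \<longleftrightarrow> y \<le> S p t" for p y t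
    using S_le_iff[of p "q p y" t] Sq by simp
  have Slow': "c * \<bar>t - s\<bar> \<le> \<bar>S p t - S p s\<bar>" and Sup': "\<bar>S p t - S p s\<bar> \<le> C * \<bar>t - s\<bar>" for p s t
  proof -
    have "c * \<bar>t - s\<bar> \<le> \<bar>S p t - S p s\<bar> \<and> \<bar>S p t - S p s\<bar> \<le> C * \<bar>t - s\<bar>"
      using Slow[of s t p] Sup[of s t p] Slow[of t s p] Sup[of t s p] S_le_iff[of p s t] S_le_iff[of p t s]
      by (cases "s \<le> t") auto
    then show "c * \<bar>t - s\<bar> \<le> \<bar>S p t - S p s\<bar>" "\<bar>S p t - S p s\<bar> \<le> C * \<bar>t - s\<bar>" by auto
  qed
  \<comment> \<open>The entry at \<open>k\<close> is frozen at 0, so that all points of a tube share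
    one index and hence one distribution function.\<close>
  define P where "P x = (\<lambda>i. if i = k then 0 else \<lfloor>x $ i\<rfloor>)" for x :: "real^'n"
  define \<pi> where "\<pi> x = (\<chi> i. if i = k then q (P x) (of_int \<lfloor>S (P x) (x $ k)\<rfloor>) else of_int \<lfloor>x $ i\<rfloor>)"
    for x
  \<comment> \<open>Rounding in the coordinates costs at most 1 each, and the move to the bottom of
    a slab at most its height 1/c.\<close>
  define D where "D = real CARD('n) + 1 / c"
  have D: "norm (\<pi> x - x) \<le> D" for x
  proof -
    let ?t = "q (P x) (of_int \<lfloor>S (P x) (x $ k)\<rfloor>)"
    have "c * \<bar>?t - x $ k\<bar> \<le> \<bar>S (P x) ?t - S (P x) (x $ k)\<bar>" by (rule Slow')
    also have "\<dots> \<le> 1" unfolding Sq by linarith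
    finally have k: "\<bar>?t - x $ k\<bar> \<le> 1 / c"
      using c by (simp add: field_simps)
    have "norm (\<pi> x - x) \<le> (\<Sum>i\<in>UNIV. \<bar>(\<pi> x - x) $ i\<bar>)"
      by (rule norm_le_l1_cart)
    also have "\<dots> \<le> (\<Sum>i\<in>UNIV. 1 + (if i = k then 1 / c else 0))"
    proof (rule sum_mono)
      fix i
      have "\<bar>of_int \<lfloor>x $ i\<rfloor> - x $ i\<bar> \<le> 1" by linarith
      with k show "\<bar>(\<pi> x - x) $ i\<bar> \<le> 1 + (if i = k then 1 / c else 0)"
        by (auto simp: \<pi>_def)
    qed
    also have "\<dots> = D" by (simp add: D_def sum.distrib)
    finally show ?thesis .
  qed
  \<comment> \<open>The image determines the tube through its integer coordinates, and within a tube
    it determines the integer level because \<open>S\<close> undoes \<open>q\<close>.\<close>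
  have \<pi>_eq_iff: "\<pi> x = \<pi> y \<longleftrightarrow> P x = P y \<and> \<lfloor>S (P y) (x $ k)\<rfloor> = \<lfloor>S (P y) (y $ k)\<rfloor>" for x y
  proof -
    have "\<pi> x = \<pi> y \<longleftrightarrow> P x = P y \<and>
        q (P x) (of_int \<lfloor>S (P x) (x $ k)\<rfloor>) = q (P y) (of_int \<lfloor>S (P y) (y $ k)\<rfloor>)"
      by (auto simp: \<pi>_def P_def vec_eq_iff fun_eq_iff)
    also have "\<dots> \<longleftrightarrow> P x = P y \<and> \<lfloor>S (P y) (x $ k)\<rfloor> = \<lfloor>S (P y) (y $ k)\<rfloor>"
      by (metis Sq of_int_eq_iff)
    finally show ?thesis .
  qed
  have "range \<pi> \<subseteq> (\<lambda>(p, j). \<chi> i. if i = k then q p (of_int j) else of_int (p i))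
      ` (UNIV :: (('n \<Rightarrow> int) \<times> int) set)"
  proof safe
    fix x
    show "\<pi> x \<in> range (\<lambda>(p, j). \<chi> i. if i = k then q p (of_int j) else of_int (p i))"
      by (rule image_eqI[of _ _ "(P x, \<lfloor>S (P x) (x $ k)\<rfloor>)"]) (auto simp: \<pi>_def P_def vec_eq_iff)
  qed
  then have "countable (range \<pi>)"
    by (rule countable_subset) simp
  moreover have "\<pi> -` {y} \<in> sets lebesgue \<and> emeasure (weighted_lebesgue w) (\<pi> -` {y}) = 1"
    if "y \<in> range \<pi>" for y
  proof -
    obtain z where z: "y = \<pi> z" using \<open>y \<in> range \<pi>\<close> by auto
    define j where "j = \<lfloor>S (P z) (z $ k)\<rfloor>"
    let ?s = "q (P z) (of_int j)" and ?t = "q (P z) (of_int j + 1)"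
    have st: "?s \<le> ?t" by (simp add: q_le_iff Sq)
    have eq: "\<pi> -` {y} = slab (P z) ?s ?t"
    proof -
      have "x \<in> \<pi> -` {y} \<longleftrightarrow> x \<in> slab (P z) ?s ?t" for x
      proof -
        have "x \<in> \<pi> -` {y} \<longleftrightarrow> P x = P z \<and> \<lfloor>S (P z) (x $ k)\<rfloor> = j"
          by (simp add: z \<pi>_eq_iff j_def)
        also have "P x = P z \<longleftrightarrow> (\<forall>i. i \<noteq> k \<longrightarrow> \<lfloor>x $ i\<rfloor> = P z i)"
          by (auto simp: P_def fun_eq_iff)
        also have "\<lfloor>S (P z) (x $ k)\<rfloor> = j \<longleftrightarrow> ?s \<le> x $ k \<and> \<not> ?t \<le> x $ k"
          unfolding q_le_iff floor_eq_iff by auto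
        finally show ?thesis by (simp add: slab_iff not_le)
      qed
      then show ?thesis by blast
    qed
    have "m (P z) ?s ?t = 1"
      using Sm[OF st, of "P z"] by (simp add: Sq)
    then show ?thesis
      unfolding eq using slab_sets[OF st] em[OF st] by simp
  qed
  ultimately have "discretizes w \<pi> D"
    using w D unfolding discretizes_def by blast
  moreover have "delone (range \<pi>)"
  proof -
    \<comment> \<open>The 1 is the gap between integer coordinates of different tubes, 1/C the least
      height of a slab.\<close>
    define \<delta> where "\<delta> = min 1 (1 / C)"
    have \<delta>: "0 < \<delta>" using C by (simp add: \<delta>_def)
    have sep: "\<delta> \<le> norm (\<pi> x - \<pi> y)" if "\<pi> x \<noteq> \<pi> y" for x y
    proof (cases "P x = P y")
      case True
      let ?a = "\<lfloor>S (P y) (x $ k)\<rfloor>" and ?b = "\<lfloor>S (P y) (y $ k)\<rfloor>"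
      have "?a \<noteq> ?b" using True \<pi>_eq_iff[of x y] that by auto
      then have "1 \<le> \<bar>real_of_int ?a - of_int ?b\<bar>" by linarith
      also have "\<dots> \<le> C * \<bar>q (P y) (of_int ?a) - q (P y) (of_int ?b)\<bar>"
        using Sup'[of "P y" "q (P y) (of_int ?a)" "q (P y) (of_int ?b)"] by (simp add: Sq)
      also have "q (P y) (of_int ?a) - q (P y) (of_int ?b) = (\<pi> x - \<pi> y) $ k"
        using True by (simp add: \<pi>_def)
      also have "C * \<bar>(\<pi> x - \<pi> y) $ k\<bar> \<le> C * norm (\<pi> x - \<pi> y)"
        using C by (intro mult_left_mono component_le_norm_cart) auto
      finally show ?thesis using C by (simp add: \<delta>_def field_simps min_le_iff_disj)
    next
      case False
      then obtain i where i: "i \<noteq> k" "\<lfloor>x $ i\<rfloor> \<noteq> \<lfloor>y $ i\<rfloor>"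
        by (auto simp: P_def fun_eq_iff split: if_splits)
      then have "1 \<le> \<bar>real_of_int \<lfloor>x $ i\<rfloor> - of_int \<lfloor>y $ i\<rfloor>\<bar>" by linarith
      also have "\<dots> = \<bar>(\<pi> x - \<pi> y) $ i\<bar>" using i by (simp add: \<pi>_def)
      also have "\<dots> \<le> norm (\<pi> x - \<pi> y)" by (rule component_le_norm_cart)
      finally show ?thesis by (simp add: \<delta>_def)
    qed
    \<comment> \<open>Two points of a closed ball of radius \<open>\<delta> / 3\<close> are at most
      \<open>2 * \<delta> / 3\<close> apart, strictly below the separation.\<close>
    have "y = z" if "y \<in> range \<pi> \<inter> cball x (\<delta> / 3)" "z \<in> range \<pi> \<inter> cball x (\<delta> / 3)" for x y z
    proof (rule ccontr)
      assume "y \<noteq> z"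
      then have "\<delta> \<le> dist y z" using that sep by (auto simp: dist_norm)
      also have "\<dots> \<le> dist x y + dist x z" by (rule dist_triangle3)
      also have "\<dots> \<le> \<delta> / 3 + \<delta> / 3" using that by (auto simp: dist_commute intro!: add_mono)
      finally show False using \<delta> by simp
    qed
    then have "\<forall>x. \<exists>\<^sub>\<le>\<^sub>1 y. y \<in> range \<pi> \<inter> cball x (\<delta> / 3)"
      unfolding Uniq_def by blast
    moreover have "\<exists>y. y \<in> range \<pi> \<inter> cball x D" for x
      using D[of x] by (intro exI[of _ "\<pi> x"]) (auto simp: dist_norm norm_minus_commute)
    moreover have "0 < D" using c by (simp add: D_def add_pos_pos)
    ultimately show ?thesis unfolding delone_def using \<delta>
      by (intro conjI exI[of _ "\<delta> / 3"] exI[of _ D]) auto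
  qed
  ultimately show thesis by (rule that)
qed

section \<open>Limits of integrals and of rescaled maps\<close>

text \<open>If the integrand is nonzero at \<open>x\<close>, then
  \<open>norm (G k x) \<le> R\<close>, so \<open>x\<close> lies in the ball of radius
  \<open>K * R + E\<close>, whatever \<open>k\<close> is; this gives the dominating function. The
  test function may vary with \<open>k\<close> so that the lemma covers both a fixed
  \<open>\<phi>\<close> along converging maps and a fixed map with \<open>\<phi>\<close> approaching
  an indicator. The origin is exempt because the rescaled weights are controlled only away from
  it.\<close>

lemma integral_weighted_composition_tendsto:
  fixes W :: "nat \<Rightarrow> real^'n \<Rightarrow> real" and G :: "nat \<Rightarrow> real^'n \<Rightarrow> real^'n" and \<phi> :: "nat \<Rightarrow> real^'n \<Rightarrow> real"
  assumes W: "\<And>k. W k \<in> borel_measurable lebesgue" "\<And>k x. \<bar>W k x\<bar> \<le> C"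
    and G: "\<And>k. G k \<in> borel_measurable lebesgue"
    and \<phi>: "\<And>k. \<phi> k \<in> borel_measurable borel" "\<And>k x. \<bar>\<phi> k x\<bar> \<le> M" "\<And>k x. R < norm x \<Longrightarrow> \<phi> k x = 0"
    and proper: "\<And>k x. norm x \<le> K * norm (G k x) + E" "0 \<le> K"
    and limit: "F \<in> borel_measurable lebesgue" "\<And>x. x \<noteq> 0 \<Longrightarrow> (\<lambda>k. W k x * \<phi> k (G k x)) \<longlonglongrightarrow> F x"
  shows "(\<lambda>k. \<integral>x. W k x * \<phi> k (G k x) \<partial>lebesgue) \<longlonglongrightarrow> (\<integral>x. F x \<partial>lebesgue)"
proof (rule integral_dominated_convergence)
  let ?B = "cball (0 :: real^'n) (K * R + E)"
  show "F \<in> borel_measurable lebesgue" by fact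
  show "(\<lambda>x. W k x * \<phi> k (G k x)) \<in> borel_measurable lebesgue" for k
    using W G \<phi> by (intro borel_measurable_times measurable_compose[OF G]) auto
  have "integrable lebesgue (indicator ?B :: real^'n \<Rightarrow> real)"
    using emeasure_lborel_cball_finite[of 0 "K * R + E"] by (subst integrable_indicator_iff) auto
  then show "integrable lebesgue (\<lambda>x. C * M * indicator ?B x :: real)"
    by (rule integrable_mult_right)
  have "AE x :: real^'n in lborel. x \<noteq> 0"
    by (rule AE_lborel_singleton)
  then have "AE x :: real^'n in lebesgue. x \<noteq> 0"
    by (rule AE_completion)
  then show "AE x in lebesgue. (\<lambda>k. W k x * \<phi> k (G k x)) \<longlonglongrightarrow> F x"
    by eventually_elim (rule limit)
  show "AE x in lebesgue. norm (W k x * \<phi> k (G k x)) \<le> C * M * indicator ?B x" for k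
  proof (rule AE_I2)
    fix x
    have "0 \<le> C" using W(2)[of k x] by simp
    show "norm (W k x * \<phi> k (G k x)) \<le> C * M * indicator ?B x"
    proof (cases "x \<in> ?B")
      case True
      then show ?thesis
        using W(2)[of k x] \<phi>(2)[of k "G k x"] \<open>0 \<le> C\<close> by (simp add: abs_mult mult_mono)
    next
      case False
      have "R < norm (G k x)"
      proof (rule ccontr)
        assume "\<not> R < norm (G k x)"
        then have "K * norm (G k x) \<le> K * R" using proper(2) by (intro mult_left_mono) auto
        with proper(1)[of x k] False show False by simp
      qed
      with \<phi>(3) False show ?thesis by simp
    qed
  qed
qed

text \<open>An Arzela-Ascoli argument for maps that may be discontinuous: the defect
  \<open>e k\<close> tends to 0, so convergence on a countable dense set, obtained by diagonal
  extraction, spreads to all points, and the limit is Lipschitz with no defect.\<close>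

lemma almost_Lipschitz_subsequence_limit:
  fixes F :: "nat \<Rightarrow> real^'n \<Rightarrow> real^'n"
  assumes lip: "\<And>k x y. norm (F k x - F k y) \<le> L * norm (x - y) + e k"
    and e: "e \<longlonglongrightarrow> 0" and L: "0 \<le> L" and bound: "\<And>k x. norm (F k x) \<le> b x"
  obtains r f where "strict_mono r" "\<And>x. (\<lambda>k. F (r k) x) \<longlonglongrightarrow> f x" "L-lipschitz_on UNIV f"
proof -
  obtain S :: "(real^'n) set" where S: "countable S"
    and dense: "\<And>X. open X \<Longrightarrow> X \<noteq> {} \<Longrightarrow> \<exists>d\<in>S. d \<in> X"
    using countable_dense_exists by metis
  have bpos: "0 < 1 + b x" for x
    using bound[of 0 x] norm_ge_zero[of "F 0 x"] by linarith
  \<comment> \<open>The extraction theorem wants a bound uniform in the point as well, so each value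
    is normalized by its own bound and restored afterwards.\<close>
  have "norm ((1 / (1 + b x)) *\<^sub>R F k x) \<le> 1" for k x
    using bound[of k x] bpos[of x] by (simp add: field_simps)
  then obtain r where r: "strict_mono r"
    and conv: "\<And>x. x \<in> S \<Longrightarrow> \<exists>l. (\<lambda>k. (1 / (1 + b x)) *\<^sub>R F (r k) x) \<longlonglongrightarrow> l"
    using function_convergent_subsequence[OF S, of "\<lambda>k x. (1 / (1 + b x)) *\<^sub>R F k x" 1] by metis
  have conv: "convergent (\<lambda>k. F (r k) x)" if "x \<in> S" for x
  proof -
    from conv[OF that] obtain l where "(\<lambda>k. (1 / (1 + b x)) *\<^sub>R F (r k) x) \<longlonglongrightarrow> l" by blast
    then have "(\<lambda>k. (1 + b x) *\<^sub>R (1 / (1 + b x)) *\<^sub>R F (r k) x) \<longlonglongrightarrow> (1 + b x) *\<^sub>R l"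
      by (intro tendsto_scaleR tendsto_const)
    then show ?thesis using bpos[of x] by (auto simp: convergent_def)
  qed
  have e': "(\<lambda>k. e (r k)) \<longlonglongrightarrow> 0"
    using LIMSEQ_subseq_LIMSEQ[OF e r] by (simp add: comp_def)
  have "Cauchy (\<lambda>k. F (r k) x)" for x
  proof (rule metric_CauchyI)
    fix \<epsilon> :: real assume \<epsilon>: "0 < \<epsilon>"
    \<comment> \<open>The denominator uses \<open>L + 1\<close> to cover \<open>L = 0\<close>. The
      budget is twice \<epsilon>/4 + \<epsilon>/8 for passing between \<open>x\<close> and
      \<open>y\<close>, and \<epsilon>/4 for the Cauchy property at \<open>y\<close>.\<close>
    obtain y where y: "y \<in> S" "y \<in> ball x (\<epsilon> / (4 * (L + 1)))"
      using dense[of "ball x (\<epsilon> / (4 * (L + 1)))"] \<epsilon> L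
      by (metis centre_in_ball add_nonneg_pos divide_pos_pos empty_iff mult_pos_pos open_ball zero_less_numeral zero_less_one)
    have "norm (x - y) * (L + 1) < \<epsilon> / 4"
      using y(2) L by (simp add: dist_norm field_simps)
    moreover have "L * norm (x - y) \<le> norm (x - y) * (L + 1)"
      by (simp add: algebra_simps)
    ultimately have Ly: "L * norm (x - y) < \<epsilon> / 4" by linarith
    have "\<forall>\<^sub>F k in sequentially. e (r k) < \<epsilon> / 8"
      using order_tendstoD(2)[OF e', of "\<epsilon> / 8"] \<epsilon> by simp
    then obtain N1 where N1: "\<And>k. N1 \<le> k \<Longrightarrow> e (r k) < \<epsilon> / 8"
      by (auto simp: eventually_sequentially)
    obtain N2 where N2: "\<And>m n. N2 \<le> m \<Longrightarrow> N2 \<le> n \<Longrightarrow> dist (F (r m) y) (F (r n) y) < \<epsilon> / 4"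
      using conv[OF y(1)] \<epsilon> metric_CauchyD[of "\<lambda>k. F (r k) y" "\<epsilon> / 4"]
      by (auto simp: Cauchy_convergent_iff)
    have "dist (F (r m) x) (F (r n) x) < \<epsilon>" if "max N1 N2 \<le> m" "max N1 N2 \<le> n" for m n
    proof -
      have "dist (F (r i) x) (F (r i) y) < \<epsilon> / 4 + \<epsilon> / 8" if "N1 \<le> i" for i
        using lip[of "r i" x y] Ly N1[OF that] by (simp add: dist_norm)
      from this[of m] this[of n] N2[of m n] that show ?thesis
        using dist_triangle[of "F (r m) x" "F (r n) x" "F (r m) y"]
          dist_triangle[of "F (r m) y" "F (r n) x" "F (r n) y"]
        by (simp add: dist_commute)
    qed
    then show "\<exists>M. \<forall>m\<ge>M. \<forall>n\<ge>M. dist (F (r m) x) (F (r n) x) < \<epsilon>"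
      by blast
  qed
  then obtain f where f: "\<And>x. (\<lambda>k. F (r k) x) \<longlonglongrightarrow> f x"
    unfolding Cauchy_convergent_iff convergent_def by metis
  have "L-lipschitz_on UNIV f"
  proof (rule lipschitz_onI)
    fix x y
    have "(\<lambda>k. norm (F (r k) x - F (r k) y)) \<longlonglongrightarrow> norm (f x - f y)"
      by (intro tendsto_intros f)
    moreover have "(\<lambda>k. L * norm (x - y) + e (r k)) \<longlonglongrightarrow> L * norm (x - y) + 0"
      by (intro tendsto_intros e')
    ultimately show "dist (f x) (f y) \<le> L * dist x y"
      unfolding dist_norm by (rule LIMSEQ_le[THEN order_trans]) (auto intro: lip)
  qed fact
  with r f that show thesis by blast
qed

text \<open>The map \<open>h\<close> lives on a discrete set; composing it with
  \<open>\<pi>A\<close> extends it to the whole space at the price of a bounded error, which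
  rescaling by \<open>s k\<close> removes. On the target side the rescaled \<open>\<pi>B\<close>
  tends to the identity, so both sides of the bijection identity have limits.\<close>

lemma scaling_limit:
  fixes h :: "real^'n \<Rightarrow> real^'n"
  assumes A: "discretizes wA \<pi>A DA" "\<And>x. 0 \<le> wA x" "\<And>x. wA x \<le> C"
    and B: "discretizes wB \<pi>B DB" "\<And>x. 0 \<le> wB x" "\<And>x. wB x \<le> C"
    and bij: "bij_betw h (range \<pi>A) (range \<pi>B)" and lip: "L-lipschitz_on (range \<pi>A) h"
    and colip: "\<And>a. a \<in> range \<pi>A \<Longrightarrow> norm (a - a0) \<le> K * norm (h a - h a0)" "0 \<le> K"
    and s: "filterlim s at_top sequentially" "\<And>k. 1 \<le> s k"
    and \<alpha>: "\<alpha> \<in> borel_measurable lebesgue" "\<And>x. x \<noteq> 0 \<Longrightarrow> (\<lambda>k. wA (s k *\<^sub>R x)) \<longlonglongrightarrow> \<alpha> x"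
    and \<beta>: "\<beta> \<in> borel_measurable lebesgue" "\<And>x. x \<noteq> 0 \<Longrightarrow> (\<lambda>k. wB (s k *\<^sub>R x)) \<longlonglongrightarrow> \<beta> x"
  obtains f where "L-lipschitz_on UNIV f" "\<And>x. norm x \<le> K * norm (f x)"
    "\<And>\<phi> R. continuous_on UNIV \<phi> \<Longrightarrow> (\<And>x. R < norm x \<Longrightarrow> \<phi> x = 0) \<Longrightarrow>
      (\<integral>x. \<alpha> x * \<phi> (f x) \<partial>lebesgue) = (\<integral>x. \<beta> x * \<phi> x \<partial>lebesgue)"
proof -
  have spos: "0 < s k" for k using s(2)[of k] by linarith
  have shrink: "c / s k \<le> c" if "0 \<le> c" for c k
    using mult_left_mono[OF s(2) that, of k] spos[of k] by (simp add: divide_le_eq)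
  have inv_s: "(\<lambda>k. c / s k) \<longlonglongrightarrow> 0" for c
    by (intro tendsto_divide_0[OF tendsto_const] filterlim_at_top_imp_at_infinity s)
  have L: "0 \<le> L" by (rule lipschitz_on_nonneg[OF lip])
  have DA: "norm (\<pi>A x - x) \<le> DA" and DB: "norm (\<pi>B x - x) \<le> DB" for x
    using A(1) B(1) by (auto simp: discretizes_def)
  have DA0: "0 \<le> DA" and DB0: "0 \<le> DB"
    using DA[of 0] DB[of 0] norm_ge_zero order_trans by blast+
  have \<pi>A_diff: "norm (\<pi>A x - \<pi>A y) \<le> norm (x - y) + 2 * DA"
    and \<pi>A_ge: "norm x \<le> DA + norm a0 + norm (\<pi>A x - a0)" for x y
    using DA[of x] DA[of y] by norm+
  define F where "F k x = (1 / s k) *\<^sub>R h (\<pi>A (s k *\<^sub>R x))" for k x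
  define P where "P k x = (1 / s k) *\<^sub>R \<pi>B (s k *\<^sub>R x)" for k x
  have lipF: "norm (F k x - F k y) \<le> L * norm (x - y) + 2 * L * DA / s k" for k x y
  proof -
    have "norm (\<pi>A (s k *\<^sub>R x) - \<pi>A (s k *\<^sub>R y)) \<le> norm (s k *\<^sub>R x - s k *\<^sub>R y) + 2 * DA"
      by (rule \<pi>A_diff)
    also have "norm (s k *\<^sub>R x - s k *\<^sub>R y) = s k * norm (x - y)"
      using spos[of k] by (simp flip: scaleR_diff_right)
    finally have "L * norm (\<pi>A (s k *\<^sub>R x) - \<pi>A (s k *\<^sub>R y)) \<le> L * (s k * norm (x - y) + 2 * DA)"
      using L by (rule mult_left_mono)
    then have "norm (h (\<pi>A (s k *\<^sub>R x)) - h (\<pi>A (s k *\<^sub>R y))) \<le> L * (s k * norm (x - y) + 2 * DA)"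
      using lipschitz_on_normD[OF lip, of "\<pi>A (s k *\<^sub>R x)" "\<pi>A (s k *\<^sub>R y)"] by simp
    moreover have "norm (F k x - F k y) = norm (h (\<pi>A (s k *\<^sub>R x)) - h (\<pi>A (s k *\<^sub>R y))) / s k"
      using spos[of k] unfolding F_def by (simp flip: scaleR_diff_right)
    ultimately show ?thesis
      using spos[of k] by (simp add: field_simps)
  qed
  have boundF: "norm (F k x) \<le> L * norm x + 2 * L * DA + norm (h (\<pi>A 0))" for k x
  proof -
    have "norm (F k 0) = norm (h (\<pi>A 0)) / s k"
      using spos[of k] by (simp add: F_def)
    also have "\<dots> \<le> norm (h (\<pi>A 0))" by (rule shrink) simp
    finally have "norm (F k 0) \<le> norm (h (\<pi>A 0))" .
    moreover have "2 * L * DA / s k \<le> 2 * L * DA" using L DA0 by (intro shrink) simp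
    ultimately show ?thesis
      using lipF[of k x 0] norm_triangle_ineq2[of "F k x" "F k 0"] by simp
  qed
  obtain r f where r: "strict_mono r" and f: "\<And>x. (\<lambda>k. F (r k) x) \<longlonglongrightarrow> f x"
    and lipf: "L-lipschitz_on UNIV f"
    using almost_Lipschitz_subsequence_limit[OF lipF inv_s L boundF] by blast
  have sub: "(\<lambda>k. X (r k)) \<longlonglongrightarrow> l" if "X \<longlonglongrightarrow> l" for X and l :: "'b::topological_space"
    using LIMSEQ_subseq_LIMSEQ[OF that r] by (simp add: comp_def)
  \<comment> \<open>All the offsets between the co-Lipschitz bound at \<open>a0\<close> and a bound
    at the origin. They do not depend on the scale, so \<open>E / s k\<close> vanishes.\<close>
  define E where "E = DA + norm a0 + K * norm (h a0)"
  have E: "0 \<le> E" using DA0 colip(2) by (simp add: E_def)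
  have properF: "norm x \<le> K * norm (F k x) + E / s k" for k x
  proof -
    let ?a = "\<pi>A (s k *\<^sub>R x)"
    have "norm (s k *\<^sub>R x) \<le> DA + norm a0 + norm (?a - a0)"
      by (rule \<pi>A_ge)
    also have "norm (?a - a0) \<le> K * norm (h ?a - h a0)" by (rule colip) simp
    also have "\<dots> \<le> K * (norm (h ?a) + norm (h a0))"
      by (intro mult_left_mono norm_triangle_ineq4 colip)
    also have "norm (h ?a) = s k * norm (F k x)"
      using spos[of k] by (simp add: F_def)
    finally show ?thesis
      using spos[of k] by (simp add: E_def field_simps)
  qed
  \<comment> \<open>The domination needs one constant for all \<open>k\<close>;
    \<open>1 \<le> s k\<close> permits dropping the denominator.\<close>
  have properF': "norm x \<le> K * norm (F k x) + E" for k x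
  proof -
    show ?thesis using properF[of x k] shrink[OF E, of k] by linarith
  qed
  have Pdist: "norm (P k x - x) \<le> DB / s k" for k x
  proof -
    have "P k x - x = (1 / s k) *\<^sub>R (\<pi>B (s k *\<^sub>R x) - s k *\<^sub>R x)"
      using spos[of k] by (simp add: P_def scaleR_diff_right)
    then show ?thesis
      using DB[of "s k *\<^sub>R x"] spos[of k] by (simp add: divide_right_mono)
  qed
  have P: "(\<lambda>k. P k x) \<longlonglongrightarrow> x" for x
    by (rule LIM_zero_cancel[OF Lim_null_comparison[OF always_eventually inv_s[of DB]]]) (simp add: Pdist)
  have properP: "norm x \<le> 1 * norm (P k x) + DB" for k x
  proof -
    show ?thesis using Pdist[of k x] shrink[OF DB0, of k] norm_triangle_ineq2[of x "P k x"]
      by (simp add: norm_minus_commute)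
  qed
  have scale: "(\<lambda>x. g (s k *\<^sub>R x)) \<in> lebesgue \<rightarrow>\<^sub>M N" if "g \<in> lebesgue \<rightarrow>\<^sub>M N" for g k and N :: "'b measure"
    using measurable_compose[OF lebesgue_measurable_scaling that] .
  have wA: "wA \<in> borel_measurable lebesgue" and wB: "wB \<in> borel_measurable lebesgue"
    using A(1) B(1) by (auto simp: discretizes_def)
  have hA: "(\<lambda>x. u (\<pi>A x)) \<in> borel_measurable lebesgue" for u :: "real^'n \<Rightarrow> 'b::topological_space"
    by (rule measurable_compose[OF discretizes_measurable[OF A(1)]]) simp
  have hB: "(\<lambda>x. u (\<pi>B x)) \<in> borel_measurable lebesgue" for u :: "real^'n \<Rightarrow> 'b::topological_space"
    by (rule measurable_compose[OF discretizes_measurable[OF B(1)]]) simp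
  have contf: "continuous_on UNIV f" by (rule lipschitz_on_continuous_on[OF lipf])
  show thesis
  proof (rule that[OF lipf])
    fix x
    have "(\<lambda>k. K * norm (F (r k) x) + E / s (r k)) \<longlonglongrightarrow> K * norm (f x) + 0"
      by (intro tendsto_intros f sub[OF inv_s])
    then show "norm x \<le> K * norm (f x)"
      by (rule LIMSEQ_le_const[where X = "\<lambda>k. K * norm (F (r k) x) + E / s (r k)", THEN order_trans])
        (auto intro: properF)
  next
    fix \<phi> :: "real^'n \<Rightarrow> real" and R
    assume \<phi>: "continuous_on UNIV \<phi>" and supp: "\<And>x. R < norm x \<Longrightarrow> \<phi> x = 0"
    have "bounded (\<phi> ` cball 0 R)"
      by (intro compact_imp_bounded compact_continuous_image continuous_on_subset[OF \<phi>]) auto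
    then obtain M where M: "0 < M" "\<And>x. x \<in> cball 0 R \<Longrightarrow> \<bar>\<phi> x\<bar> \<le> M"
      by (auto simp: bounded_pos)
    have bound: "\<bar>\<phi> x\<bar> \<le> M" for x
      using M(1) M(2)[of x] supp[of x] by (cases "R < norm x") auto
    have \<phi>m: "\<phi> \<in> borel_measurable borel"
      by (rule borel_measurable_continuous_onI[OF \<phi>])
    have \<phi>lim: "(\<lambda>k. \<phi> (X k)) \<longlonglongrightarrow> \<phi> l" if "X \<longlonglongrightarrow> l" for X l
      using \<phi> that continuous_on_tendsto_compose[of UNIV \<phi> X l sequentially] by simp
    have limA: "(\<lambda>k. \<integral>x. wA (s (r k) *\<^sub>R x) * \<phi> (F (r k) x) \<partial>lebesgue) \<longlonglongrightarrow> (\<integral>x. \<alpha> x * \<phi> (f x) \<partial>lebesgue)"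
    proof (rule integral_weighted_composition_tendsto[where \<phi> = "\<lambda>_. \<phi>" and C = C and K = K])
      show "F (r k) \<in> borel_measurable lebesgue" for k
        unfolding F_def by (rule scale[OF hA])
      have "f \<in> borel_measurable lebesgue"
        using borel_measurable_continuous_onI[OF contf] by (intro measurable_completion) simp
      then show "(\<lambda>x. \<alpha> x * \<phi> (f x)) \<in> borel_measurable lebesgue"
        using \<alpha>(1) \<phi>m by measurable
      show "(\<lambda>k. wA (s (r k) *\<^sub>R x) * \<phi> (F (r k) x)) \<longlonglongrightarrow> \<alpha> x * \<phi> (f x)" if "x \<noteq> 0" for x
        by (intro tendsto_mult sub[OF \<alpha>(2)] \<phi>lim f that)
      show "\<bar>wA (s (r k) *\<^sub>R x)\<bar> \<le> C" for k x using A by simp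
    qed (use scale[OF wA] \<phi>m bound supp properF' colip in auto)
    have limB: "(\<lambda>k. \<integral>x. wB (s (r k) *\<^sub>R x) * \<phi> (P (r k) x) \<partial>lebesgue) \<longlonglongrightarrow> (\<integral>x. \<beta> x * \<phi> x \<partial>lebesgue)"
    proof (rule integral_weighted_composition_tendsto[where \<phi> = "\<lambda>_. \<phi>" and C = C and K = 1])
      show "P (r k) \<in> borel_measurable lebesgue" for k
        unfolding P_def by (rule scale[OF hB])
      show "(\<lambda>x. \<beta> x * \<phi> x) \<in> borel_measurable lebesgue"
        using measurable_completion[of \<phi> lborel borel] \<beta>(1) \<phi>m by simp
      show "(\<lambda>k. wB (s (r k) *\<^sub>R x) * \<phi> (P (r k) x)) \<longlonglongrightarrow> \<beta> x * \<phi> x" if "x \<noteq> 0" for x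
        by (intro tendsto_mult sub[OF \<beta>(2)] \<phi>lim sub[OF P] that)
      show "\<bar>wB (s (r k) *\<^sub>R x)\<bar> \<le> C" for k x using B by simp
    qed (use scale[OF wB] \<phi>m bound supp properP in auto)
    \<comment> \<open>The bijection identity is applied to the dilated test function; the
      substitution of \<open>s k *\<^sub>R x\<close> for \<open>x\<close> gives the same Jacobian
      factor on both sides.\<close>
    have same: "(\<integral>x. wA (s k *\<^sub>R x) * \<phi> (F k x) \<partial>lebesgue) = (\<integral>x. wB (s k *\<^sub>R x) * \<phi> (P k x) \<partial>lebesgue)" for k
    proof -
      let ?\<psi> = "\<lambda>y. \<phi> ((1 / s k) *\<^sub>R y)"
      have "(\<integral>x. wA x * ?\<psi> (h (\<pi>A x)) \<partial>lebesgue) = (\<integral>x. wB x * ?\<psi> (\<pi>B x) \<partial>lebesgue)"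
        by (rule integral_discretizes_bij[OF A(1,2) B(1,2) bij])
      moreover have "(\<integral>x. wA x * ?\<psi> (h (\<pi>A x)) \<partial>lebesgue) =
          s k ^ CARD('n) * (\<integral>x. wA (s k *\<^sub>R x) * \<phi> (F k x) \<partial>lebesgue)"
        unfolding F_def by (rule lebesgue_integral_scaleR[OF spos]) (intro borel_measurable_times wA hA)
      moreover have "(\<integral>x. wB x * ?\<psi> (\<pi>B x) \<partial>lebesgue) =
          s k ^ CARD('n) * (\<integral>x. wB (s k *\<^sub>R x) * \<phi> (P k x) \<partial>lebesgue)"
        unfolding P_def by (rule lebesgue_integral_scaleR[OF spos]) (intro borel_measurable_times wB hB)
      ultimately show ?thesis using spos[of k] by simp
    qed
    show "(\<integral>x. \<alpha> x * \<phi> (f x) \<partial>lebesgue) = (\<integral>x. \<beta> x * \<phi> x \<partial>lebesgue)"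
      using limA limB unfolding same by (rule LIMSEQ_unique)
  qed
qed

section \<open>From test functions to equality of measures\<close>

text \<open>The continuous functions \<open>min 1 (real n * infdist x (- U))\<close> increase to the
  indicator of the open set \<open>U\<close> and vanish outside it, so they turn identities for test
  functions into identities for measures of open sets.\<close>

lemma measure_vimage_open_limit:
  fixes f :: "real^'n \<Rightarrow> real^'n"
  assumes \<alpha>: "\<alpha> \<in> borel_measurable lebesgue" "\<And>x. 0 \<le> \<alpha> x" "\<And>x. \<alpha> x \<le> C"
    and f: "f \<in> borel_measurable lebesgue" "\<And>x. norm x \<le> K * norm (f x)" "0 \<le> K"
    and U: "open U" "bounded U"
  shows "(\<lambda>n. \<integral>x. \<alpha> x * min 1 (real n * infdist (f x) (- U)) \<partial>lebesgue)
      \<longlonglongrightarrow> measure (weighted_lebesgue \<alpha>) (f -` U)"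
    and "emeasure (weighted_lebesgue \<alpha>) (f -` U) < \<infinity>"
proof -
  let ?\<phi> = "\<lambda>n x. min 1 (real n * infdist x (- U))"
  obtain R where R: "\<And>x. x \<in> U \<Longrightarrow> norm x \<le> R"
    using U(2) by (auto simp: bounded_iff)
  \<comment> \<open>By convention the distance to the empty set is 0, which would make the
    approximating functions vanish.\<close>
  have "- U \<noteq> {}"
    using U(2) not_bounded_UNIV[where 'a = "real^'n"] by (auto simp: Compl_eq_Diff_UNIV Diff_eq_empty_iff top.extremum_unique)
  then have pos: "0 < infdist x (- U)" if "x \<in> U" for x
    using infdist_pos_not_in_closed[of "- U" x] U(1) that by auto
  have fU: "f -` U \<in> sets lebesgue"
    using measurable_sets[OF f(1), of U] U(1) by simp
  have mono: "emeasure lebesgue (f -` U) \<le> emeasure lebesgue (cball (0::real^'n) (K * R))"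
  proof (intro emeasure_mono subsetI)
    fix x assume "x \<in> f -` U"
    then have "K * norm (f x) \<le> K * R" using R f(3) by (intro mult_left_mono) auto
    with f(2)[of x] show "x \<in> cball 0 (K * R)" by simp
  qed simp
  have "emeasure (weighted_lebesgue \<alpha>) (f -` U) \<le> ennreal C * emeasure lebesgue (f -` U)"
    using order_trans[OF \<alpha>(2,3)] by (intro emeasure_weighted_lebesgue_le \<alpha> fU)
  also have "\<dots> \<le> ennreal C * emeasure lebesgue (cball (0::real^'n) (K * R))"
    by (intro mult_left_mono mono) simp
  also have "\<dots> < \<infinity>"
    using emeasure_lborel_cball_finite[of "0 :: real^'n" "K * R"] by (auto simp: ennreal_mult_less_top)
  finally show fin: "emeasure (weighted_lebesgue \<alpha>) (f -` U) < \<infinity>" .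
  have "(\<lambda>n. \<integral>x. \<alpha> x * ?\<phi> n (f x) \<partial>lebesgue) \<longlonglongrightarrow> (\<integral>x. \<alpha> x * indicator (f -` U) x \<partial>lebesgue)"
  proof (rule integral_weighted_composition_tendsto[where \<phi> = ?\<phi> and C = C and K = K and M = 1 and E = 0 and R = R])
    show "(\<lambda>x. \<alpha> x * indicator (f -` U) x) \<in> borel_measurable lebesgue"
      using \<alpha>(1) fU by (intro borel_measurable_times borel_measurable_indicator)
    show "?\<phi> n \<in> borel_measurable borel" for n
      by (intro borel_measurable_continuous_onI continuous_intros)
    show "\<bar>?\<phi> n x\<bar> \<le> 1" for n x
      using infdist_nonneg[of x "- U"] by (simp add: abs_le_iff min_def)
    show "?\<phi> n x = 0" if "R < norm x" for n x
      using R[of x] that by (force simp: infdist_zero)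
    show "(\<lambda>n. \<alpha> x * ?\<phi> n (f x)) \<longlonglongrightarrow> \<alpha> x * indicator (f -` U) x" for x
    proof (intro tendsto_mult tendsto_const)
      show "(\<lambda>n. ?\<phi> n (f x)) \<longlonglongrightarrow> indicator (f -` U) x"
      proof (cases "f x \<in> U")
        case True
        have "\<forall>\<^sub>F n in sequentially. 1 / infdist (f x) (- U) \<le> real n"
          by (metis eventually_sequentiallyI nat_ceiling_le_eq)
        then have "\<forall>\<^sub>F n in sequentially. ?\<phi> n (f x) = 1"
          by eventually_elim (use pos[OF True] in \<open>simp add: field_simps\<close>)
        then show ?thesis using True by (simp add: tendsto_eventually)
      next
        case False
        then show ?thesis by (simp add: infdist_zero)
      qed
    qed
  qed (use \<alpha> f in auto)
  also have "(\<integral>x. \<alpha> x * indicator (f -` U) x \<partial>lebesgue) = measure (weighted_lebesgue \<alpha>) (f -` U)"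
  proof -
    have "(\<integral>x. \<alpha> x * indicator (f -` U) x \<partial>lebesgue) = (\<integral>x. indicator (f -` U) x \<partial>weighted_lebesgue \<alpha>)"
      unfolding weighted_lebesgue_def using \<alpha> fU by (subst integral_density) auto
    then show ?thesis by simp
  qed
  finally show "(\<lambda>n. \<integral>x. \<alpha> x * ?\<phi> n (f x) \<partial>lebesgue) \<longlonglongrightarrow> measure (weighted_lebesgue \<alpha>) (f -` U)" .
qed

text \<open>Boxes form an intersection-stable generator of finite mass, which settles Borel sets.
  The passage to Lebesgue sets is a separate matter: a continuous map may pull a Lebesgue set back
  to a nonmeasurable one, and the lower bound on \<open>\<alpha>\<close> excludes this.\<close>

lemma distr_weighted_lebesgue_eq:
  fixes f :: "real^'n \<Rightarrow> real^'n"
  assumes \<alpha>: "\<alpha> \<in> borel_measurable lebesgue" "\<And>x. c \<le> \<alpha> x" "\<And>x. \<alpha> x \<le> C" "0 < c"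
    and \<beta>: "\<beta> \<in> borel_measurable lebesgue" "\<And>x. 0 \<le> \<beta> x" "\<And>x. \<beta> x \<le> C"
    and f: "continuous_on UNIV f" "\<And>x. norm x \<le> K * norm (f x)" "0 \<le> K"
    and eq: "\<And>\<phi> R. continuous_on UNIV \<phi> \<Longrightarrow> (\<And>x. R < norm x \<Longrightarrow> \<phi> x = 0) \<Longrightarrow>
      (\<integral>x. \<alpha> x * \<phi> (f x) \<partial>lebesgue) = (\<integral>x. \<beta> x * \<phi> x \<partial>lebesgue)"
  shows "f \<in> lebesgue \<rightarrow>\<^sub>M lebesgue" "distr (weighted_lebesgue \<alpha>) lebesgue f = weighted_lebesgue \<beta>"
proof -
  have \<alpha>0: "0 \<le> \<alpha> x" for x using \<alpha>(2)[of x] \<alpha>(4) by simp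
  have C: "0 \<le> C" using \<alpha>(3)[of 0] \<alpha>0[of 0] by simp
  have fb: "f \<in> borel_measurable lebesgue"
    using borel_measurable_continuous_onI[OF f(1)] by (intro measurable_completion) simp
  have box: "emeasure (weighted_lebesgue \<alpha>) (f -` box a b) = emeasure (weighted_lebesgue \<beta>) (box a b)" for a b
  proof -
    let ?\<phi> = "\<lambda>n x. min 1 (real n * infdist x (- box a b))"
    obtain R where R: "\<And>x. x \<in> box a b \<Longrightarrow> norm x \<le> R"
      using bounded_box[of a b] by (auto simp: bounded_iff)
    have "?\<phi> n x = 0" if "R < norm x" for n x
      using R[of x] that by (force simp: infdist_zero)
    then have int: "(\<integral>x. \<alpha> x * ?\<phi> n (f x) \<partial>lebesgue) = (\<integral>x. \<beta> x * ?\<phi> n (id x) \<partial>lebesgue)" for n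
      unfolding id_apply by (intro eq) (auto intro!: continuous_intros)
    note * = measure_vimage_open_limit[OF \<alpha>(1) \<alpha>0 \<alpha>(3) fb f(2,3) open_box bounded_box, of a b]
    \<comment> \<open>The identity is proper with constant 1, so the same approximation computes the
      target measure of the box.\<close>
    note ** = measure_vimage_open_limit[OF \<beta> _ _ _ open_box bounded_box, of id 1 a b]
    have "measure (weighted_lebesgue \<alpha>) (f -` box a b) = measure (weighted_lebesgue \<beta>) (id -` box a b)"
      using *(1) **(1) unfolding int by (intro LIMSEQ_unique) auto
    with *(2) **(2) show ?thesis by (simp add: emeasure_eq_ennreal_measure)
  qed
  have fw: "f \<in> weighted_lebesgue \<alpha> \<rightarrow>\<^sub>M borel" and idw: "id \<in> weighted_lebesgue \<beta> \<rightarrow>\<^sub>M borel"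
    using fb by (auto cong: measurable_cong_sets)
  have "distr (weighted_lebesgue \<alpha>) borel f = distr (weighted_lebesgue \<beta>) borel id"
  proof (rule measure_eqI_generator_eq[where E = "range (\<lambda>(a, b). box a b :: (real^'n) set)" and \<Omega> = UNIV
        and A = "\<lambda>i. box (- (real i *\<^sub>R One)) (real i *\<^sub>R One)"])
    show "Int_stable (range (\<lambda>(a, b). box a b :: (real^'n) set))"
      by (auto simp: Int_stable_def box_Int_box)
    show "emeasure (distr (weighted_lebesgue \<alpha>) borel f) X = emeasure (distr (weighted_lebesgue \<beta>) borel id) X"
      if "X \<in> range (\<lambda>(a, b). box a b)" for X
      using that box by (auto simp: emeasure_distr[OF fw] emeasure_distr[OF idw])
    show "emeasure (distr (weighted_lebesgue \<alpha>) borel f) (box (- (real i *\<^sub>R One)) (real i *\<^sub>R One)) \<noteq> \<infinity>" for i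
      using measure_vimage_open_limit(2)[OF \<alpha>(1) \<alpha>0 \<alpha>(3) fb f(2,3) open_box bounded_box]
      by (auto simp: emeasure_distr[OF fw] less_top[symmetric])
  qed (auto simp: UN_box_eq_UNIV borel_eq_box sets_measure_of)
  then have borel: "emeasure (weighted_lebesgue \<alpha>) (f -` X) = emeasure (weighted_lebesgue \<beta>) X"
    if "X \<in> sets borel" for X
    using that emeasure_distr[OF fw that] emeasure_distr[OF idw that] by simp
  \<comment> \<open>By the Borel case, \<open>c\<close> times the volume of the preimage is at most
    \<open>C\<close> times the volume of the set, so null sets pull back to null sets.\<close>
  have "null_sets lborel \<subseteq> null_sets (distr lebesgue lborel f)"
  proof
    fix N :: "(real^'n) set" assume N: "N \<in> null_sets lborel"
    then have Nb: "N \<in> sets borel" by auto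
    have fN: "f -` N \<in> sets lebesgue" using measurable_sets[OF fb Nb] by simp
    have "ennreal c * emeasure lebesgue (f -` N) \<le> emeasure (weighted_lebesgue \<alpha>) (f -` N)"
      using \<alpha> fN by (intro emeasure_weighted_lebesgue_ge) auto
    also have "\<dots> = emeasure (weighted_lebesgue \<beta>) N" by (rule borel[OF Nb])
    also have "\<dots> \<le> ennreal C * emeasure lebesgue N"
      using \<beta> C Nb by (intro emeasure_weighted_lebesgue_le) auto
    also have "\<dots> = 0" using null_setsD1[OF null_sets_completionI[OF N]] by (simp only: mult_zero_right)
    finally have "emeasure lebesgue (f -` N) = 0" using \<alpha>(4) by (simp add: ennreal_eq_0_iff not_le)
    then show "N \<in> null_sets (distr lebesgue lborel f)"
      using fb Nb by (auto simp: null_sets_def emeasure_distr)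
  qed
  then show fl: "f \<in> lebesgue \<rightarrow>\<^sub>M lebesgue"
    using fb by (intro completion.measurable_completion2) auto
  \<comment> \<open>A Lebesgue set is squeezed between Borel sets \<open>S\<close> and
    \<open>S \<union> N'\<close> of equal \<open>\<beta>\<close>-mass; their preimages squeeze its
    preimage.\<close>
  show "distr (weighted_lebesgue \<alpha>) lebesgue f = weighted_lebesgue \<beta>"
  proof (rule measure_eqI)
    fix X assume "X \<in> sets (distr (weighted_lebesgue \<alpha>) lebesgue f)"
    then have X: "X \<in> sets lebesgue" by simp
    then obtain S N N' where SN: "X = S \<union> N" "N \<subseteq> N'" "N' \<in> null_sets lborel" "S \<in> sets lborel"
      by (rule sets_completionE)
    have fw': "f \<in> weighted_lebesgue \<alpha> \<rightarrow>\<^sub>M lebesgue"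
      using fl by (simp cong: measurable_cong_sets)
    have sets: "f -` Z \<in> sets lebesgue" if "Z \<in> sets lebesgue" for Z
      using measurable_sets[OF fl that] by simp
    have S: "S \<in> sets borel" and N': "N' \<in> sets borel" using SN by auto
    have "emeasure (weighted_lebesgue \<beta>) N' \<le> ennreal C * emeasure lebesgue N'"
      using \<beta> C N' by (intro emeasure_weighted_lebesgue_le) auto
    also have "\<dots> = 0" using null_setsD1[OF null_sets_completionI[OF SN(3)]] by (simp only: mult_zero_right)
    finally have "emeasure (weighted_lebesgue \<beta>) N' = 0" by simp
    moreover have "emeasure (weighted_lebesgue \<beta>) (S \<union> N') \<le>
        emeasure (weighted_lebesgue \<beta>) S + emeasure (weighted_lebesgue \<beta>) N'"
      using S N' by (intro emeasure_subadditive) auto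
    ultimately have upper: "emeasure (weighted_lebesgue \<beta>) (S \<union> N') \<le> emeasure (weighted_lebesgue \<beta>) S"
      by simp
    have sub: "f -` S \<subseteq> f -` X" "f -` X \<subseteq> f -` (S \<union> N')" "S \<subseteq> X" "X \<subseteq> S \<union> N'"
      using SN by auto
    have meas: "f -` X \<in> sets (weighted_lebesgue \<alpha>)" "f -` (S \<union> N') \<in> sets (weighted_lebesgue \<alpha>)"
      "X \<in> sets (weighted_lebesgue \<beta>)" "S \<union> N' \<in> sets (weighted_lebesgue \<beta>)"
      using sets[OF X] sets[of "S \<union> N'"] X S N' by simp_all
    have "emeasure (weighted_lebesgue \<alpha>) (f -` S) \<le> emeasure (weighted_lebesgue \<alpha>) (f -` X)"
      "emeasure (weighted_lebesgue \<alpha>) (f -` X) \<le> emeasure (weighted_lebesgue \<alpha>) (f -` (S \<union> N'))"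
      "emeasure (weighted_lebesgue \<beta>) S \<le> emeasure (weighted_lebesgue \<beta>) X"
      "emeasure (weighted_lebesgue \<beta>) X \<le> emeasure (weighted_lebesgue \<beta>) (S \<union> N')"
      by (intro emeasure_mono sub meas)+
    then have "emeasure (weighted_lebesgue \<alpha>) (f -` X) = emeasure (weighted_lebesgue \<beta>) X"
      using upper borel[OF S] borel[of "S \<union> N'"] S N' by (metis order.trans order_antisym sets.Un)
    then show "emeasure (distr (weighted_lebesgue \<alpha>) lebesgue f) X = emeasure (weighted_lebesgue \<beta>) X"
      using X by (simp add: emeasure_distr[OF fw'])
  qed simp
qed

section \<open>Lipschitz regularity by volume packing\<close>

text \<open>The transport identity bounds the volume of a preimage by C/c times the volume of the
  set. This limits the number of \<open>R\<close>-separated points in the preimage of a ball of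
  radius \<open>R\<close>, and a largest such family is an \<open>R\<close>-net.\<close>

lemma lipschitz_regular_if_distr_weighted_lebesgue:
  fixes f :: "real^'n \<Rightarrow> real^'n"
  assumes \<alpha>: "\<alpha> \<in> borel_measurable lebesgue" "\<And>x. c \<le> \<alpha> x" "0 < c"
    and \<beta>: "\<beta> \<in> borel_measurable lebesgue" "\<And>x. \<beta> x \<le> C" "0 \<le> C"
    and f: "L-lipschitz_on UNIV f" "f \<in> lebesgue \<rightarrow>\<^sub>M lebesgue"
    and distr: "distr (weighted_lebesgue \<alpha>) lebesgue f = weighted_lebesgue \<beta>"
  shows "lipschitz_regular_on UNIV UNIV f"
proof -
  define d where "d = CARD('n)"
  define V where "V = unit_ball_vol (real d)"
  have V: "0 < V" by (simp add: V_def)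
  have L: "0 \<le> L" by (rule lipschitz_on_nonneg[OF f(1)])
  have vol_ball: "emeasure lebesgue (ball x r) = ennreal (V * r ^ d)" if "0 \<le> r" for x :: "real^'n" and r
    using emeasure_ball[OF that, of x] by (simp add: V_def d_def)
  have vimage: "ennreal c * emeasure lebesgue (f -` X) \<le> ennreal C * emeasure lebesgue X"
    if X: "X \<in> sets lebesgue" for X
  proof -
    have fX: "f -` X \<in> sets lebesgue" using measurable_sets[OF f(2) X] by simp
    have "ennreal c * emeasure lebesgue (f -` X) \<le> emeasure (weighted_lebesgue \<alpha>) (f -` X)"
      using \<alpha> fX by (intro emeasure_weighted_lebesgue_ge) auto
    also have "\<dots> = emeasure (distr (weighted_lebesgue \<alpha>) lebesgue f) X"
      using f(2) X by (subst emeasure_distr) (auto cong: measurable_cong_sets)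
    also have "\<dots> \<le> ennreal C * emeasure lebesgue X"
      unfolding distr using \<beta> X by (intro emeasure_weighted_lebesgue_le) auto
    finally show ?thesis .
  qed
  \<comment> \<open>Disjoint balls of radius R/2 around separated points are mapped into a ball of
    radius R + LR/2 = R(L+2)/2. The ratio of the two radii is L+2, independent of
    \<open>R\<close>.\<close>
  define B where "B = C * (L + 2) ^ d / c"
  have packing: "real (card T) \<le> B"
    if T: "finite T" "T \<subseteq> f -` ball x R" "\<And>p q. p \<in> T \<Longrightarrow> q \<in> T \<Longrightarrow> p \<noteq> q \<Longrightarrow> R \<le> dist p q"
      and R: "0 < R" for T x R
  proof -
    let ?U = "\<Union>p\<in>T. ball p (R / 2)"
    have disj: "disjoint_family_on (\<lambda>p. ball p (R / 2)) T"
    proof (unfold disjoint_family_on_def, intro ballI impI, rule ccontr)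
      fix p q assume pq: "p \<in> T" "q \<in> T" "p \<noteq> q" "ball p (R / 2) \<inter> ball q (R / 2) \<noteq> {}"
      then obtain z where "dist p z < R / 2" "dist q z < R / 2" by auto
      then have "dist p q < R" using dist_triangle2[of p q z] by simp
      with T(3) pq show False by fastforce
    qed
    have sub: "?U \<subseteq> f -` ball x (R * (L + 2) / 2)"
    proof
      fix z assume "z \<in> ?U"
      then obtain p where p: "p \<in> T" and z: "z \<in> ball p (R / 2)" by blast
      have "dist (f p) (f z) \<le> L * dist p z" by (rule lipschitz_onD[OF f(1)]) auto
      also have "\<dots> \<le> L * (R / 2)" using z L by (intro mult_left_mono) auto
      finally have "dist x (f z) < R + L * (R / 2)"
        using T(2) p dist_triangle[of x "f z" "f p"] by fastforce
      then show "z \<in> f -` ball x (R * (L + 2) / 2)" by (simp add: field_simps)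
    qed
    have "(\<Sum>p\<in>T. emeasure lebesgue (ball p (R / 2))) = (\<Sum>p\<in>T. ennreal (V * (R / 2) ^ d))"
      using R by (intro sum.cong vol_ball) auto
    also have "\<dots> = ennreal (real (card T) * (V * (R / 2) ^ d))"
      using R V by (simp add: ennreal_mult ennreal_of_nat_eq_real_of_nat)
    finally have "ennreal (c * (real (card T) * (V * (R / 2) ^ d))) =
        ennreal c * (\<Sum>p\<in>T. emeasure lebesgue (ball p (R / 2)))"
      using \<alpha>(3) R V by (simp only: ennreal_mult'[OF less_imp_le])
    also have "(\<Sum>p\<in>T. emeasure lebesgue (ball p (R / 2))) = emeasure lebesgue ?U"
      using T(1) disj by (intro sum_emeasure) auto
    also have "ennreal c * emeasure lebesgue ?U \<le> ennreal c * emeasure lebesgue (f -` ball x (R * (L + 2) / 2))"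
      using measurable_sets[OF f(2), of "ball x (R * (L + 2) / 2)"] sub
      by (intro mult_left_mono emeasure_mono) auto
    also have "\<dots> \<le> ennreal C * emeasure lebesgue (ball x (R * (L + 2) / 2))"
      by (rule vimage) simp
    also have "\<dots> = ennreal (C * (V * (R * (L + 2) / 2) ^ d))"
      using R L V \<beta>(3) by (subst vol_ball) (auto simp: ennreal_mult)
    finally have "c * (real (card T) * (V * (R / 2) ^ d)) \<le> C * (V * (R * (L + 2) / 2) ^ d)"
      using R L V \<beta>(3) by (simp add: ennreal_le_iff)
    also have "(R * (L + 2) / 2) ^ d = (R / 2) ^ d * (L + 2) ^ d"
      by (simp add: power_mult_distrib power_divide)
    finally have "(V * (R / 2) ^ d) * (c * real (card T)) \<le> (V * (R / 2) ^ d) * (C * (L + 2) ^ d)"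
      by (simp add: ac_simps)
    then have "c * real (card T) \<le> C * (L + 2) ^ d"
      using V R by (subst (asm) mult_le_cancel_left_pos) auto
    then show ?thesis using \<alpha>(3) by (simp add: B_def field_simps)
  qed
  \<comment> \<open>\<open>N\<close> is both the number of balls and the dilation factor; the
    successor makes it at least 1, so that the dilated balls contain those of radius
    \<open>R\<close>.\<close>
  define N where "N = Suc (nat \<lceil>B\<rceil>)"
  have "\<exists>T\<subseteq>UNIV. finite T \<and> card T \<le> N \<and> UNIV \<inter> f -` ball x R \<subseteq> (\<Union>p\<in>T. ball p (real N * R))"
    if R: "0 < R" for x R
  proof -
    let ?sep = "\<lambda>T. finite T \<and> T \<subseteq> f -` ball x R \<and> (\<forall>p\<in>T. \<forall>q\<in>T. p \<noteq> q \<longrightarrow> R \<le> dist p q)"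
    have bound: "card T \<le> N" if "?sep T" for T
      using packing[of T x R] that R unfolding N_def by (smt (verit) le_SucI le_nat_iff of_nat_le_iff nat_le_real_less real_nat_ceiling_ge)
    have "\<exists>T. ?sep T \<and> (\<forall>T'. ?sep T' \<longrightarrow> card T' \<le> card T)"
      by (rule ex_has_greatest_nat[of ?sep "{}" card "Suc N"]) (simp, intro allI impI le_imp_less_Suc bound)
    then obtain T where T: "?sep T" and max: "\<And>T'. ?sep T' \<Longrightarrow> card T' \<le> card T"
      by blast
    have "f -` ball x R \<subseteq> (\<Union>p\<in>T. ball p (real N * R))"
    proof
      fix z assume z: "z \<in> f -` ball x R"
      show "z \<in> (\<Union>p\<in>T. ball p (real N * R))"
      proof (rule ccontr)
        assume nz: "z \<notin> (\<Union>p\<in>T. ball p (real N * R))"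
        have "R \<le> real N * R" using R by (simp add: N_def)
        with nz have far: "R \<le> dist p z" if "p \<in> T" for p
          using that by fastforce
        then have "z \<notin> T" using R by force
        moreover have "?sep (insert z T)"
          using T z far by (auto simp: dist_commute)
        ultimately show False using max[of "insert z T"] T by simp
      qed
    qed
    with T bound[OF T] show ?thesis by auto
  qed
  moreover have "1 \<le> N" by (simp add: N_def)
  ultimately show ?thesis
    unfolding lipschitz_regular_on_def lipschitz_map_on_def using f(1) by blast
qed

section \<open>From a bijection of discrete sets to a transport map\<close>

text \<open>Source and target weights are kept arbitrary so that both alternatives of the hypothesis
  are instances, with the constant weight 1 on the target side in one and on the source side in the
  other.\<close>

lemma lipschitz_regular_transport:
  fixes h :: "real^'n \<Rightarrow> real^'n"
  assumes A: "discretizes wA \<pi>A DA" "\<And>x. 0 \<le> wA x" "\<And>x. wA x \<le> C"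
    and B: "discretizes wB \<pi>B DB" "\<And>x. 0 \<le> wB x" "\<And>x. wB x \<le> C"
    and bij: "bij_betw h (range \<pi>A) (range \<pi>B)" and lip: "L-lipschitz_on (range \<pi>A) h"
    and colip: "\<And>a. a \<in> range \<pi>A \<Longrightarrow> norm (a - a0) \<le> K * norm (h a - h a0)" "0 \<le> K"
    and s: "filterlim s at_top sequentially" "\<And>k. 1 \<le> s k"
    and \<alpha>: "\<alpha> \<in> borel_measurable lebesgue" "\<And>x. c \<le> \<alpha> x" "\<And>x. \<alpha> x \<le> C" "0 < c"
      "\<And>x. x \<noteq> 0 \<Longrightarrow> (\<lambda>k. wA (s k *\<^sub>R x)) \<longlonglongrightarrow> \<alpha> x"
    and \<beta>: "\<beta> \<in> borel_measurable lebesgue" "\<And>x. 0 \<le> \<beta> x" "\<And>x. \<beta> x \<le> C"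
      "\<And>x. x \<noteq> 0 \<Longrightarrow> (\<lambda>k. wB (s k *\<^sub>R x)) \<longlonglongrightarrow> \<beta> x"
  shows "\<exists>f. lipschitz_regular_on UNIV UNIV f \<and>
    distr (weighted_lebesgue \<alpha>) lebesgue f = weighted_lebesgue \<beta>"
proof -
  obtain f where f: "L-lipschitz_on UNIV f" "\<And>x. norm x \<le> K * norm (f x)"
    and eq: "\<And>\<phi> R. continuous_on UNIV \<phi> \<Longrightarrow> (\<And>x. R < norm x \<Longrightarrow> \<phi> x = 0) \<Longrightarrow>
      (\<integral>x. \<alpha> x * \<phi> (f x) \<partial>lebesgue) = (\<integral>x. \<beta> x * \<phi> x \<partial>lebesgue)"
    using scaling_limit[OF A B bij lip colip s \<alpha>(1,5) \<beta>(1,4)] by blast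
  have *: "f \<in> lebesgue \<rightarrow>\<^sub>M lebesgue" "distr (weighted_lebesgue \<alpha>) lebesgue f = weighted_lebesgue \<beta>"
    by (rule distr_weighted_lebesgue_eq[OF \<alpha>(1-4) \<beta>(1-3) lipschitz_on_continuous_on[OF f(1)] f(2) colip(2)];
        fact eq)+
  have "0 \<le> C" using order_trans[OF \<beta>(2,3)] .
  then have "lipschitz_regular_on UNIV UNIV f"
    using lipschitz_regular_if_distr_weighted_lebesgue[OF \<alpha>(1,2,4) \<beta>(1,3) _ f(1) *] by blast
  with *(2) show ?thesis by blast
qed

section \<open>A weight with prescribed rescalings at the origin\<close>

text \<open>The weight \<open>w\<close> looks like \<open>\<rho>\<close> around the origin at each of the scales \<open>2 ^ (k * k)\<close>, whose
  ratios tend to infinity.\<close>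

lemma multiscale_weight:
  fixes \<rho> :: "real^'n \<Rightarrow> real"
  assumes \<rho>: "\<rho> \<in> borel_measurable lebesgue"
  obtains w where "w \<in> borel_measurable lebesgue" "range w \<subseteq> range \<rho>"
    "\<And>x. x \<noteq> 0 \<Longrightarrow> (\<lambda>k. w (2 ^ (k * k) *\<^sub>R x)) \<longlonglongrightarrow> \<rho> x"
proof -
  \<comment> \<open>Since (k-1) + (k-1)^2 = k^2 - k, the level set of \<open>\<kappa>\<close> at k >
    0 is the shell 2^(k^2-k) < norm x \<le> 2^(k^2+k). Division by 2^(k^2) maps it to 2^(-k) < norm
    x \<le> 2^k, and these shells exhaust the space without the origin.\<close>
  define \<kappa> where "\<kappa> x = (LEAST k. norm x \<le> 2 ^ (k + k * k))" for x :: "real^'n"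
  define w where "w x = \<rho> ((1 / 2 ^ (\<kappa> x * \<kappa> x)) *\<^sub>R x)" for x
  have ex: "\<exists>k. norm x \<le> 2 ^ (k + k * k)" for x :: "real^'n"
  proof -
    obtain k where "norm x < 2 ^ k" using real_arch_pow[of 2 "norm x"] by auto
    also have "(2 :: real) ^ k \<le> 2 ^ (k + k * k)" by (intro power_increasing) auto
    finally show ?thesis by (intro exI[of _ k]) simp
  qed
  have \<kappa>_le: "\<kappa> x \<le> k \<longleftrightarrow> norm x \<le> 2 ^ (k + k * k)" for x k
  proof
    assume "\<kappa> x \<le> k"
    then have "(2 :: real) ^ (\<kappa> x + \<kappa> x * \<kappa> x) \<le> 2 ^ (k + k * k)"
      by (intro power_increasing add_mono mult_mono) auto
    with LeastI_ex[OF ex[of x]] show "norm x \<le> 2 ^ (k + k * k)"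
      unfolding \<kappa>_def by (rule order_trans)
  qed (simp add: \<kappa>_def Least_le)
  have "{x :: real^'n. norm x \<le> 2 ^ (k + k * k)} = cball 0 (2 ^ (k + k * k))" for k
    by auto
  then have \<kappa>m: "\<kappa> \<in> lebesgue \<rightarrow>\<^sub>M count_space UNIV"
    unfolding \<kappa>_def by (intro measurable_Least) (simp add: pred_def)
  have "w \<in> borel_measurable lebesgue"
    unfolding w_def
    by (rule measurable_compose_countable[OF _ \<kappa>m])
      (rule measurable_compose[OF lebesgue_measurable_scaling \<rho>])
  moreover have "range w \<subseteq> range \<rho>" by (auto simp: w_def)
  moreover have "(\<lambda>k. w (2 ^ (k * k) *\<^sub>R x)) \<longlonglongrightarrow> \<rho> x" if "x \<noteq> 0" for x
  proof (rule tendsto_eventually)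
    obtain N where N: "norm x < 2 ^ N" "1 / norm x < 2 ^ N"
      using real_arch_pow[of 2 "max (norm x) (1 / norm x)"] by auto
    have "w (2 ^ (k * k) *\<^sub>R x) = \<rho> x" if k: "Suc N \<le> k" for k
    proof -
      \<comment> \<open>The index before \<open>k\<close>, whose outer radius is the inner radius of
        shell \<open>k\<close>; excluding \<open>\<kappa> \<le> j\<close> places the rescaled point
        in shell \<open>k\<close> exactly.\<close>
      obtain j where j: "k = Suc j" "N \<le> j" using k by (cases k) auto
      have pow: "(2::real) ^ N \<le> 2 ^ k" "(2::real) ^ N \<le> 2 ^ j"
        by (rule power_increasing; use j in simp)+
      have "\<kappa> (2 ^ (k * k) *\<^sub>R x) \<le> k"
        unfolding \<kappa>_le using order_trans[OF less_imp_le[OF N(1)] pow(1)] by (simp add: power_add)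
      moreover have "\<not> \<kappa> (2 ^ (k * k) *\<^sub>R x) \<le> j"
      proof
        assume "\<kappa> (2 ^ (k * k) *\<^sub>R x) \<le> j"
        then have "2 ^ (k * k) * norm x \<le> 2 ^ (j + j * j)" by (simp add: \<kappa>_le)
        also have "k * k = Suc j + (j + j * j)" by (simp add: j)
        finally have "2 ^ Suc j * norm x \<le> 1" by (simp add: power_add)
        moreover have "1 < 2 ^ j * norm x"
        proof -
          have "1 < 2 ^ N * norm x" using N(2) \<open>x \<noteq> 0\<close> by (simp add: field_simps)
          also have "\<dots> \<le> 2 ^ j * norm x" using pow by (intro mult_right_mono) auto
          finally show ?thesis .
        qed
        ultimately show False by simp
      qed
      ultimately have "\<kappa> (2 ^ (k * k) *\<^sub>R x) = k" using j by simp
      then show ?thesis by (simp add: w_def)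
    qed
    then show "\<forall>\<^sub>F k in sequentially. w (2 ^ (k * k) *\<^sub>R x) = \<rho> x"
      by (auto simp: eventually_sequentially)
  qed
  ultimately show thesis by (rule that)
qed

section \<open>The two alternatives of the hypothesis\<close>

theorem theorem1p10:
  assumes "\<forall>Y :: (real^'n) set. delone Y \<longrightarrow>
      (\<exists>g. bij_betw g Y int_lattice \<and> lipschitz_map_on Y g \<and> pointwise_co_lipschitz_on Y g) \<or>
      (\<exists>g. bij_betw g Y int_lattice \<and> co_lipschitz_on Y g \<and> pointwise_lipschitz_on Y g)"
  shows "\<forall>\<rho> :: real^'n \<Rightarrow> real.
      \<rho> \<in> borel_measurable lebesgue \<and>
      0 < (INF x. ereal (\<rho> x)) \<and>
      (INF x. ereal (\<rho> x)) \<le> (SUP x. ereal (\<rho> x)) \<and>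
      (SUP x. ereal (\<rho> x)) < \<infinity> \<longrightarrow>
      (\<exists>f :: real^'n \<Rightarrow> real^'n. lipschitz_regular_on UNIV UNIV f \<and>
         (distr (weighted_lebesgue \<rho>) lebesgue f = lebesgue \<or>
          distr lebesgue lebesgue f = weighted_lebesgue \<rho>))"
proof (intro allI impI, elim conjE)
  fix \<rho> :: "real^'n \<Rightarrow> real"
  assume \<rho>: "\<rho> \<in> borel_measurable lebesgue"
    and inf: "0 < (INF x. ereal (\<rho> x))" and sup: "(SUP x. ereal (\<rho> x)) < \<infinity>"
  obtain c where c: "0 < c" "\<And>x. c \<le> \<rho> x"
  proof -
    obtain c where "ereal 0 < ereal c" "ereal c < (INF x. ereal (\<rho> x))"
      using ereal_dense2[OF inf] by (auto simp: zero_ereal_def)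
    with that show thesis by (metis INF_lower UNIV_I ereal_less_eq(3) less_ereal.simps(1) less_imp_le order.trans)
  qed
  \<comment> \<open>Taking \<open>1 \<le> C\<close> lets the same constant bound the weight 1 of the
    lattice.\<close>
  obtain C where C: "1 \<le> C" "\<And>x. \<rho> x \<le> C"
  proof -
    obtain C where "(SUP x. ereal (\<rho> x)) < ereal C"
      using ereal_dense2[OF sup] by auto
    then have "\<rho> x \<le> max 1 C" for x
      by (metis SUP_upper UNIV_I ereal_less_eq(3) less_imp_le max.coboundedI2 order.trans)
    with that[of "max 1 C"] show thesis by simp
  qed
  obtain w where w: "w \<in> borel_measurable lebesgue" "range w \<subseteq> range \<rho>"
    and wlim: "\<And>x. x \<noteq> 0 \<Longrightarrow> (\<lambda>k. w (2 ^ (k * k) *\<^sub>R x)) \<longlonglongrightarrow> \<rho> x"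
    using multiscale_weight[OF \<rho>] by blast
  have wc: "c \<le> w x" and wC: "w x \<le> C" for x
    using w(2) c(2) C(2) by (metis rangeE rangeI subsetD)+
  obtain \<pi> D where d: "discretizes w \<pi> D" and delone: "delone (range \<pi>)"
    using delone_discretization[OF w(1) c(1) wc wC] by blast
  define \<pi>Z where "\<pi>Z = (\<lambda>x :: real^'n. \<chi> i. real_of_int \<lfloor>x $ i\<rfloor>)"
  have Z: "range \<pi>Z = int_lattice" "discretizes (\<lambda>_. 1) \<pi>Z (real CARD('n))"
    unfolding \<pi>Z_def by (rule lattice_discretizes)+
  have w0: "0 \<le> w x" and \<rho>0: "0 \<le> \<rho> x" for x
    using wc[of x] c(2)[of x] c(1) by linarith+
  have scale: "filterlim (\<lambda>k. 2 ^ (k * k) :: real) at_top sequentially" "\<And>k. 1 \<le> (2 ^ (k * k) :: real)"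
  proof -
    have "real k \<le> 2 ^ (k * k)" for k
    proof -
      have "real k \<le> 2 ^ k" using of_nat_less_two_power[of k, where 'a = real] by simp
      also have "\<dots> \<le> 2 ^ (k * k)" by (intro power_increasing) auto
      finally show ?thesis .
    qed
    then show "filterlim (\<lambda>k. 2 ^ (k * k) :: real) at_top sequentially"
      by (intro filterlim_at_top_mono[OF filterlim_real_sequentially]) simp
  qed simp
  \<comment> \<open>The base point at which the pointwise condition will be evaluated; any point of
    the Delone set will do.\<close>
  obtain y where y: "y \<in> range \<pi>" by blast
  have one: "(\<lambda>_. 1 :: real) \<in> borel_measurable lebesgue"
    by simp
  consider g where "bij_betw g (range \<pi>) int_lattice" "lipschitz_map_on (range \<pi>) g"
      "pointwise_co_lipschitz_on (range \<pi>) g"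
    | g where "bij_betw g (range \<pi>) int_lattice" "co_lipschitz_on (range \<pi>) g"
      "pointwise_lipschitz_on (range \<pi>) g"
    using assms delone by blast
  then show "\<exists>f :: real^'n \<Rightarrow> real^'n. lipschitz_regular_on UNIV UNIV f \<and>
         (distr (weighted_lebesgue \<rho>) lebesgue f = lebesgue \<or>
          distr lebesgue lebesgue f = weighted_lebesgue \<rho>)"
  proof cases
    case (1 g)
    obtain L where L: "L-lipschitz_on (range \<pi>) g"
      using 1(2) by (auto simp: lipschitz_map_on_def)
    have inv: "inv_into (range \<pi>) g (g a) = a" if "a \<in> range \<pi>" for a
      using 1(1) that by (simp add: bij_betw_inv_into_left)
    obtain K where K: "K > 0" "\<And>z. z \<in> g ` range \<pi> \<Longrightarrow>
        norm (inv_into (range \<pi>) g z - inv_into (range \<pi>) g (g y)) \<le> K * norm (z - g y)"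
      using 1(3) y unfolding pointwise_co_lipschitz_on_def pointwise_lipschitz_on_def lipschitz_at_def
      by blast
    have colip: "norm (a - y) \<le> K * norm (g a - g y)" if "a \<in> range \<pi>" for a
      using K(2)[of "g a"] that by (simp add: inv y)
    have "\<exists>f. lipschitz_regular_on UNIV UNIV f \<and>
        distr (weighted_lebesgue \<rho>) lebesgue f = weighted_lebesgue (\<lambda>_. 1)"
      using lipschitz_regular_transport[OF d w0 wC Z(2) _ C(1) _ L colip less_imp_le[OF K(1)] scale
          \<rho> c(2) C(2) c(1) wlim one _ C(1)] 1(1) Z(1) by simp
    then show ?thesis by (auto simp: weighted_lebesgue_one)
  next
    case (2 g)
    \<comment> \<open>Here the inverse is the Lipschitz map, so the lattice becomes the source and
      \<open>\<rho>\<close> the target density.\<close>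
    let ?h = "inv_into (range \<pi>) g"
    have img: "g ` range \<pi> = int_lattice" using 2(1) by (simp add: bij_betw_def)
    obtain L where L: "L-lipschitz_on (range \<pi>Z) ?h"
      using 2(2) by (auto simp: co_lipschitz_on_def lipschitz_map_on_def img Z)
    have bij: "bij_betw ?h (range \<pi>Z) (range \<pi>)"
      using bij_betw_inv_into[OF 2(1)] by (simp add: Z)
    have inv: "?h (g a) = a" if "a \<in> range \<pi>" for a
      using 2(1) that by (simp add: bij_betw_inv_into_left)
    obtain K where K: "K > 0" "\<And>x. x \<in> range \<pi> \<Longrightarrow> norm (g x - g y) \<le> K * norm (x - y)"
      using 2(3) y unfolding pointwise_lipschitz_on_def lipschitz_at_def by blast
    \<comment> \<open>The pointwise Lipschitz bound for \<open>g\<close> at \<open>y\<close>, read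
      backwards, is the co-Lipschitz bound for its inverse at the lattice point
      \<open>g y\<close>.\<close>
    have colip: "norm (a - g y) \<le> K * norm (?h a - ?h (g y))" if "a \<in> range \<pi>Z" for a
    proof -
      have "a \<in> g ` range \<pi>" using that img Z(1) by simp
      then obtain x where "x \<in> range \<pi>" "a = g x" by blast
      then show ?thesis using K(2)[of x] by (simp only: inv y)
    qed
    have "\<exists>f. lipschitz_regular_on UNIV UNIV f \<and>
        distr (weighted_lebesgue (\<lambda>_. 1)) lebesgue f = weighted_lebesgue \<rho>"
      using lipschitz_regular_transport[OF Z(2) _ C(1) d w0 wC bij L colip less_imp_le[OF K(1)] scale
          one order_refl C(1) zero_less_one _ \<rho> \<rho>0 C(2) wlim] by simp
    then show ?thesis by (auto simp: weighted_lebesgue_one)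
  qed
qed

end
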